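(* Let $\Lambda=\Lambda(\Omega)$ be a model set, $Q$ a linear similarity compatible with $\Lambda$, $T=T_Q$ the associated set of translations, and $p\in\mathcal C(\Lambda)$ the unique $Q$-invariant density of $\Lambda$ in $\mathcal C(\Lambda)$. For $k\in\mathbb R^m$ let $$g(k)=\lim_{s\to\infty}\frac1{\#T_s}\sum_{v\in T_s}e^{-2\pi ik\cdot v},\qquad h(k)=\lim_{s\to\infty}\frac1{\#\Lambda_s}\sum_{w\in\Lambda_s}p(w)e^{-2\pi ik\cdot w}.$$ Then for all $k\in\mathbb R^m$ $$h(k)=\prod_{N=0}^\infty g\big((Q^t)^Nk\big).$$
   Context: Cut and project scheme: $\mathbb R^m$ (physical space) and $\mathbb R^n$ (internal space) are Euclidean spaces, $\mathbb R^m\times\mathbb R^n$ is their orthogonal sum, $\pi_1,\pi_2$ are the projections onto $\mathbb R^m$ and $\mathbb R^n$, and $\tilde L\subset\mathbb R^m\times\mathbb R^n$ is a lattice such that $\pi_1|_{\tilde L}$ is injective and $\pi_2(\tilde L)$ is dense in $\mathbb R^n$. Put $L=\pi_1(\tilde L)$ and let $(\,)^*=\pi_2\circ(\pi_1|_{\tilde L})^{-1}:L\to\mathbb R^n$. For $\Omega\subset\mathbb R^n$, $\Lambda(\Omega)=\{x\in L\mid x^*\in\Omega\}$; it is a model set if $\Omega$ is compact, $\Omega=\overline{\mathrm{int}(\Omega)}$, and $\partial\Omega$ has Lebesgue measure $0$. Standing assumptions: $0\in\Lambda$ and $0\in\mathrm{int}(\Omega)$. A linear similarity is $Q=qR$ with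 $R$ an orthogonal transformation of $\mathbb R^m$ and $q$ real. It is assumed that $QL=L$. Then $Q$ induces an automorphism of the lattice $\tilde L$ and a linear map $A=Q^*$ of $\mathbb R^n$ with $(Qx)^*=A(x^* )$ for $x\in L$; it is assumed that all eigenvalues of $A$ have absolute value less than $1$. Define $\Omega_Q=\{u\in\mathbb R^n\mid A\Omega+u\subset\Omega\}$. $Q$ is compatible with $\Lambda$ if $\mathrm{int}(\Omega_Q)\neq\emptyset$. It is always assumed that $\partial\Omega_Q$ has Lebesgue measure $0$. Put $T=T_Q=\{v\in L\mid v^*\in\Omega_Q\}$ and $t_v(x)=Qx+v$ for $v\in T$. For $S\subset\mathbb R^m$ and $s\ge0$, $S_s=\{x\in S\mid|x|\le s\}$; $\#$ denotes cardinality; $Q^t$ is the transpose of $Q$. Averaging and invariant densities: for a function $p$ on $L$ vanishing off $\Lambda$, $(\mathcal Ap)(x)=\lim_{s\to\infty}\frac{|\det(Q)|}{\#T_s}\sum_{v\in T_s}p(t_v^{-1}x)$ for $x\in L$, provided the limit exists. A function $p:L\to\mathbb R$ vanishing off $\Lambda$ is a $Q$-invariant density on $\Lambda$ if (1) $p\ge0$ on $\Lambda$; (2) $\mathcal Ap=p$; (3) $\lim_{s\to\infty}\frac1{\#\Lambda_s}\sum_{x\in\Lambda_s}p(x)=1$. $\mathcal C(\Omega)$ is the space of continuous complex-valued functions on $\mathbb R^n$ with support in $\Omega$, and $\mathcal C(\Lambda)$ is the space of functions $p_f$ on $L$, $f\in\mathcal C(\Omega)$, with $p_f(x)=\mathrm{vol}(\Omega)f(x^*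 )$ for $x\in\Lambda$ and $p_f(x)=0$ otherwise. There is a unique $Q$-invariant density in $\mathcal C(\Lambda)$; it is $p=p_f$ with $f$ determined by $\hat f(k)=\prod_{N=0}^\infty\hat{\mathbf 1}_{\Omega_Q}((A^t)^Nk)/\mathrm{vol}(\Omega_Q)$, where $\hat f(k)=\int_{\mathbb R^n}e^{-2\pi ik\cdot x}f(x)\,dx$. *)

theory Defs
  imports "HOL-Analysis.Analysis"
begin

definition is_lattice :: "'a::euclidean_space set \<Rightarrow> bool" where
  "is_lattice \<Gamma> \<longleftrightarrow>
     (\<exists>B. independent B \<and> span B = UNIV \<and>
          \<Gamma> = {\<Sum>b\<in>B. real_of_int (c b) *\<^sub>R b | c. True})"

(* The product type carries the inner product of the orthogonal sum; fst and snd are the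
   projections onto physical and internal space. *)
definition cut_and_project_scheme :: "((real^'m) \<times> (real^'n)) set \<Rightarrow> bool" where
  "cut_and_project_scheme Lt \<longleftrightarrow>
     is_lattice Lt \<and> inj_on fst Lt \<and> closure (snd ` Lt) = UNIV"

(* Meaningful only on fst ` Lt. *)
definition star_map :: "((real^'m) \<times> (real^'n)) set \<Rightarrow> real^'m \<Rightarrow> real^'n" where
  "star_map Lt x = snd (the_inv_into Lt fst x)"

definition cp_set :: "((real^'m) \<times> (real^'n)) set \<Rightarrow> (real^'n) set \<Rightarrow> (real^'m) set" where
  "cp_set Lt W = {x \<in> fst ` Lt. star_map Lt x \<in> W}"

definition model_set_window :: "(real^'n) set \<Rightarrow> bool" where
  "model_set_window \<Omega> \<longleftrightarrow>
     compact \<Omega> \<and> \<Omega> = closure (interior \<Omega>) \<and> frontier \<Omega> \<in> null_sets lebesgue"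

definition linear_similarity :: "real^'m^'m \<Rightarrow> bool" where
  "linear_similarity Q \<longleftrightarrow> (\<exists>q R. orthogonal_matrix R \<and> Q = q *\<^sub>R R)"

(* Eigenvalues of a real matrix are taken over the complex numbers. *)
definition complex_eigenvalue :: "real^'n^'n \<Rightarrow> complex \<Rightarrow> bool" where
  "complex_eigenvalue A c \<longleftrightarrow>
     (\<exists>v. v \<noteq> 0 \<and> map_matrix complex_of_real A *v v = c *s v)"

(* A is the map induced by Q on internal space; it is determined by Q because
   star_map Lt has dense range on fst ` Lt. *)
definition induced_internal_map ::
    "((real^'m) \<times> (real^'n)) set \<Rightarrow> real^'m^'m \<Rightarrow> real^'n^'n \<Rightarrow> bool" where
  "induced_internal_map Lt Q A \<longleftrightarrow>
     (\<forall>x \<in> fst ` Lt. star_map Lt (Q *v x) = A *v star_map Lt x)"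

definition window_translations :: "real^'n^'n \<Rightarrow> (real^'n) set \<Rightarrow> (real^'n) set" where
  "window_translations A \<Omega> = {u. (\<lambda>y. A *v y + u) ` \<Omega> \<subseteq> \<Omega>}"

definition compatible_window :: "real^'n^'n \<Rightarrow> (real^'n) set \<Rightarrow> bool" where
  "compatible_window A \<Omega> \<longleftrightarrow> interior (window_translations A \<Omega>) \<noteq> {}"

definition sim_translations ::
    "((real^'m) \<times> (real^'n)) set \<Rightarrow> real^'n^'n \<Rightarrow> (real^'n) set \<Rightarrow> (real^'m) set" where
  "sim_translations Lt A \<Omega> = {v \<in> fst ` Lt. star_map Lt v \<in> window_translations A \<Omega>}"

definition ball_part :: "'a::real_normed_vector set \<Rightarrow> real \<Rightarrow> 'a set" where
  "ball_part S s = {x \<in> S. norm x \<le> s}"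

definition affine_sim :: "real^'m^'m \<Rightarrow> real^'m \<Rightarrow> real^'m \<Rightarrow> real^'m" where
  "affine_sim Q v x = Q *v x + v"

(* Functions on L = fst ` Lt are represented by functions on the whole space, of which only
   the values on L are used.  The second conjunct says that the limit defining the averaged
   density exists at every point of L and reproduces p. *)
definition invariant_density ::
    "((real^'m) \<times> (real^'n)) set \<Rightarrow> (real^'n) set \<Rightarrow> real^'m^'m \<Rightarrow> real^'n^'n \<Rightarrow>
     (real^'m \<Rightarrow> real) \<Rightarrow> bool" where
  "invariant_density Lt \<Omega> Q A p \<longleftrightarrow>
     (\<forall>x \<in> fst ` Lt. x \<notin> cp_set Lt \<Omega> \<longrightarrow> p x = 0) \<and>
     (\<forall>x \<in> cp_set Lt \<Omega>. p x \<ge> 0) \<and>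
     (\<forall>x \<in> fst ` Lt.
        ((\<lambda>s. \<bar>det Q\<bar> / real (card (ball_part (sim_translations Lt A \<Omega>) s)) *
              (\<Sum>v \<in> ball_part (sim_translations Lt A \<Omega>) s. p (inv (affine_sim Q v) x)))
          \<longlongrightarrow> p x) at_top) \<and>
     ((\<lambda>s. 1 / real (card (ball_part (cp_set Lt \<Omega>) s)) *
           (\<Sum>x \<in> ball_part (cp_set Lt \<Omega>) s. p x)) \<longlongrightarrow> 1) at_top"

definition continuous_supported :: "(real^'n) set \<Rightarrow> (real^'n \<Rightarrow> complex) set" where
  "continuous_supported \<Omega> = {f. continuous_on UNIV f \<and> closure {y. f y \<noteq> 0} \<subseteq> \<Omega>}"

definition density_of ::
    "((real^'m) \<times> (real^'n)) set \<Rightarrow> (real^'n) set \<Rightarrow> (real^'n \<Rightarrow> complex) \<Rightarrow> real^'m \<Rightarrow> complex" where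
  "density_of Lt \<Omega> f x =
     (if x \<in> cp_set Lt \<Omega> then complex_of_real (measure lebesgue \<Omega>) * f (star_map Lt x) else 0)"

definition continuous_densities ::
    "((real^'m) \<times> (real^'n)) set \<Rightarrow> (real^'n) set \<Rightarrow> (real^'m \<Rightarrow> complex) set" where
  "continuous_densities Lt \<Omega> = density_of Lt \<Omega> ` continuous_supported \<Omega>"

definition character :: "real^'m \<Rightarrow> real^'m \<Rightarrow> complex" where
  "character k x = exp (- 2 * complex_of_real pi * \<i> * complex_of_real (k \<bullet> x))"

end

theory Submission
  imports Defs
begin

text \<open>A fundamental domain of the lattice can be cut into pieces and translated by lattice vectors into
  an arbitrarily thin slab around physical space, because the internal projection of the lattice is
  dense. Comparing a lattice sum over a large ball with the integral then gives equidistribution of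
  the starred points in any window with null boundary. For a frequency \<open>k\<close> the character of the
  lattice either depends continuously on the internal coordinate, and is then the restriction of a
  character \<open>\<psi>\<close> of internal space, or translating by lattice vectors with small internal coordinate
  forces all twisted means to vanish. In the second case both sides are 0. In the first case
  \<open>h k = \<integral> f \<psi>\<close> and \<open>g k\<close> is the mean of \<open>\<psi>\<close> over \<open>\<Omega>\<^sub>Q\<close>; invariance of the density is the
  refinement equation for \<open>f\<close>, which says \<open>h k = g k * h (Q\<^sup>t k)\<close>, and \<open>Q\<^sup>t\<close> replaces \<open>\<psi>\<close> by
  \<open>\<psi> \<circ> A\<close>. Since the powers of \<open>A\<close> tend to 0, iterating gives the product.\<close>

section \<open>Lattice sums\<close>

text \<open>Lattice sums are compared with integrals by averaging over a fundamental domain. The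
  obstacle is that such a domain is not small, so its points cause large internal displacements.
  Density removes this: \<open>z\<close> in the domain may be replaced by \<open>z - t\<close> with
  \<open>t\<close> in the lattice. The physical displacement is then bounded by a constant that
  depends on the internal accuracy but not on the radius, and its effect is a shell around a sphere,
  negligible against the volume of the ball. The refinement equation is obtained at the internal
  coordinates of lattice points, where invariance of the density speaks, and extends because both
  sides are continuous. Its integral against a character carries a constant made of
  \<open>det Q\<close> and the Jacobian of \<open>A\<close>. The constant is the same for all
  characters, so its value 1 can be read off at the trivial one, where both the mean and the
  integral of the density are 1; no determinant has to be computed. Factors of the product may
  vanish. The partial products are therefore isolated by dividing by the remaining factor, which
  tends to 1.\<close>

lemma is_lattice_0: "is_lattice \<Gamma> \<Longrightarrow> 0 \<in> \<Gamma>"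
  unfolding is_lattice_def by (auto intro!: exI[of _ "\<lambda>_. 0"])

lemma is_lattice_diff:
  assumes "is_lattice \<Gamma>" "x \<in> \<Gamma>" "y \<in> \<Gamma>"
  shows "x - y \<in> \<Gamma>"
proof -
  obtain B where G: "\<Gamma> = {\<Sum>b\<in>B. real_of_int (c b) *\<^sub>R b | c. True}"
    using assms(1) unfolding is_lattice_def by auto
  obtain c d where "x = (\<Sum>b\<in>B. real_of_int (c b) *\<^sub>R b)" "y = (\<Sum>b\<in>B. real_of_int (d b) *\<^sub>R b)"
    using assms(2,3) unfolding G by auto
  then have "x - y = (\<Sum>b\<in>B. real_of_int (c b - d b) *\<^sub>R b)"
    by (simp add: sum_subtractf scaleR_diff_left)
  then show ?thesis
    unfolding G by (auto intro!: exI[of _ "\<lambda>b. c b - d b"])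
qed

lemma is_lattice_minus: "is_lattice \<Gamma> \<Longrightarrow> x \<in> \<Gamma> \<Longrightarrow> - x \<in> \<Gamma>"
  using is_lattice_diff[of \<Gamma> 0 x] is_lattice_0[of \<Gamma>] by simp

lemma is_lattice_add: "is_lattice \<Gamma> \<Longrightarrow> x \<in> \<Gamma> \<Longrightarrow> y \<in> \<Gamma> \<Longrightarrow> x + y \<in> \<Gamma>"
  using is_lattice_diff[of \<Gamma> x "- y"] is_lattice_minus[of \<Gamma> y] by simp

text \<open>Serves to show that the physical projection of the lattice spans, so that a matrix
  mapping it onto itself is invertible.\<close>

lemma is_lattice_span:
  assumes "is_lattice \<Gamma>"
  shows "span \<Gamma> = UNIV"
proof -
  obtain B where B: "independent B" "span B = UNIV"
    and G: "\<Gamma> = {\<Sum>b\<in>B. real_of_int (c b) *\<^sub>R b | c. True}"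
    using assms unfolding is_lattice_def by auto
  have fin: "finite B"
    using B(1) by (rule independent_imp_finite)
  have "B \<subseteq> \<Gamma>"
  proof
    fix b assume "b \<in> B"
    then have "(\<Sum>a\<in>B. real_of_int (if a = b then 1 else 0) *\<^sub>R a) = (\<Sum>a\<in>B. if a = b then a else 0)"
      by (intro sum.cong) auto
    then have "b = (\<Sum>a\<in>B. real_of_int (if a = b then 1 else 0) *\<^sub>R a)"
      using fin \<open>b \<in> B\<close> by simp
    then show "b \<in> \<Gamma>"
      unfolding G by (intro CollectI exI[of _ "\<lambda>a. if a = b then 1 else 0"]) simp
  qed
  then show ?thesis
    using span_mono[of B \<Gamma>] B(2) by auto
qed

text \<open>Coordinates on a finite-dimensional space are bounded linear; finiteness in bounded sets
  and the fundamental domain are both read off from them.\<close>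

lemma is_lattice_coordinates:
  fixes \<Gamma> :: "'a::euclidean_space set"
  assumes "is_lattice \<Gamma>"
  obtains B :: "'a set" and r :: "'a \<Rightarrow> 'a \<Rightarrow> real"
  where "finite B" "\<And>b. b \<in> B \<Longrightarrow> bounded_linear (\<lambda>z. r z b)"
    "\<And>z. z = (\<Sum>b\<in>B. r z b *\<^sub>R b)"
    "\<And>c b. b \<in> B \<Longrightarrow> r (\<Sum>b\<in>B. c b *\<^sub>R b) b = c b"
    "\<Gamma> = {\<Sum>b\<in>B. real_of_int (c b) *\<^sub>R b | c. True}"
proof -
  obtain B where B: "independent B" "span B = UNIV"
    and G: "\<Gamma> = {\<Sum>b\<in>B. real_of_int (c b) *\<^sub>R b | c. True}"
    using assms unfolding is_lattice_def by auto
  have fin: "finite B"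
    using B(1) by (rule independent_imp_finite)
  have sumrep: "(\<Sum>b\<in>B. representation B z b *\<^sub>R b) = z" for z
    by (rule real_vector.sum_representation_eq) (use B fin in auto)
  have coord: "representation B (\<Sum>b\<in>B. c b *\<^sub>R b) b = c b" if "b \<in> B" for c b
  proof -
    have "representation B (\<Sum>b\<in>B. c b *\<^sub>R b) = (\<lambda>b. if b \<in> B then c b else 0)"
      by (rule real_vector.representation_eqI) (use B fin in \<open>auto intro: finite_subset split: if_splits\<close>,
        (rule sum.mono_neutral_cong_left; use fin in auto))
    then show ?thesis
      using that by simp
  qed
  show thesis
    by (rule that[OF fin bounded_linear_representation[OF B] sumrep[symmetric] coord G])
qed

text \<open>Coordinates are bounded on a bounded set and integral on the lattice, so only finitely
  many coefficient families occur.\<close>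

lemma is_lattice_finite_Int_bounded:
  fixes \<Gamma> :: "'a::euclidean_space set"
  assumes "is_lattice \<Gamma>" "bounded S"
  shows "finite (\<Gamma> \<inter> S)"
proof -
  obtain B r where B: "finite B" "\<And>b. b \<in> B \<Longrightarrow> bounded_linear (\<lambda>z. r z b)"
    and "\<And>z. z = (\<Sum>b\<in>B. r z b *\<^sub>R b)"
    and r: "\<And>c b. b \<in> B \<Longrightarrow> r (\<Sum>b\<in>B. c b *\<^sub>R b) b = c b"
    and G: "\<Gamma> = {\<Sum>b\<in>B. real_of_int (c b) *\<^sub>R b | c. True}"
    using is_lattice_coordinates[OF assms(1)] by blast
  have "\<exists>n::int. \<forall>z\<in>S. \<bar>r z b\<bar> \<le> n" if "b \<in> B" for b
  proof -
    have "bounded ((\<lambda>z. r z b) ` S)"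
      using B(2)[OF that] assms(2) by (rule bounded_linear_image[rotated])
    then obtain M where "\<And>z. z \<in> S \<Longrightarrow> \<bar>r z b\<bar> \<le> M"
      unfolding bounded_iff by auto
    then show ?thesis
      by (intro exI[of _ "\<lceil>M\<rceil>"]) (meson le_of_int_ceiling order_trans)
  qed
  then obtain n :: "'a \<Rightarrow> int" where n: "\<And>b z. b \<in> B \<Longrightarrow> z \<in> S \<Longrightarrow> \<bar>r z b\<bar> \<le> n b"
    by metis
  \<comment> \<open>Coefficient functions are restricted to \<open>B\<close>, because their values
    elsewhere are arbitrary and would spoil finiteness.\<close>
  have "\<Gamma> \<inter> S \<subseteq> (\<lambda>c. \<Sum>b\<in>B. real_of_int (c b) *\<^sub>R b) ` (PiE B (\<lambda>b. {- n b..n b}))"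
  proof
    fix z assume z: "z \<in> \<Gamma> \<inter> S"
    then obtain c where c: "z = (\<Sum>b\<in>B. real_of_int (c b) *\<^sub>R b)"
      unfolding G by auto
    have "\<bar>real_of_int (c b)\<bar> \<le> n b" if "b \<in> B" for b
      using n[OF that, of z] r[OF that, of "\<lambda>b. real_of_int (c b)"] z c by auto
    then have "restrict c B \<in> PiE B (\<lambda>b. {- n b..n b})"
      by (auto simp: abs_le_iff) (linarith | smt (verit) of_int_le_iff of_int_minus)+
    moreover have "z = (\<Sum>b\<in>B. real_of_int (restrict c B b) *\<^sub>R b)"
      unfolding c by (rule sum.cong) auto
    ultimately show "z \<in> (\<lambda>c. \<Sum>b\<in>B. real_of_int (c b) *\<^sub>R b) ` (PiE B (\<lambda>b. {- n b..n b}))"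
      by blast
  qed
  moreover have "finite (PiE B (\<lambda>b. {- n b..n b}))"
    using B(1) by (intro finite_PiE) auto
  ultimately show ?thesis
    using finite_surj by blast
qed

text \<open>\<open>D\<close> is the half-open parallelepiped of the basis; the unique lattice vector
  consists of the integer parts of the coordinates.\<close>

lemma is_lattice_fundamental_domain:
  fixes \<Gamma> :: "'a::euclidean_space set"
  assumes "is_lattice \<Gamma>"
  obtains D where "D \<in> sets borel" "bounded D" "\<And>z. \<exists>!l. l \<in> \<Gamma> \<and> z - l \<in> D"
proof -
  obtain B r where B: "finite B" "\<And>b. b \<in> B \<Longrightarrow> bounded_linear (\<lambda>z. r z b)"
    and sumrep: "\<And>z. z = (\<Sum>b\<in>B. r z b *\<^sub>R b)"
    and r: "\<And>c b. b \<in> B \<Longrightarrow> r (\<Sum>b\<in>B. c b *\<^sub>R b) b = c b"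
    and G: "\<Gamma> = {\<Sum>b\<in>B. real_of_int (c b) *\<^sub>R b | c. True}"
    using is_lattice_coordinates[OF assms] by blast
  define D where "D = {z. \<forall>b\<in>B. 0 \<le> r z b \<and> r z b < 1}"
  have [measurable]: "(\<lambda>z. r z b) \<in> borel_measurable borel" if "b \<in> B" for b
    using B(2)[OF that] by (intro borel_measurable_continuous_onI linear_continuous_on)
  have "D \<in> sets borel"
    unfolding D_def using B(1) by measurable
  moreover have "bounded D"
    unfolding bounded_iff
  proof (intro exI ballI)
    fix z assume "z \<in> D"
    then have z: "\<And>b. b \<in> B \<Longrightarrow> \<bar>r z b\<bar> \<le> 1"
      unfolding D_def by force
    have "norm z = norm (\<Sum>b\<in>B. r z b *\<^sub>R b)"
      by (subst sumrep[of z]) (rule refl)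
    also have "\<dots> \<le> (\<Sum>b\<in>B. norm b)"
      using z by (intro sum_norm_le) (simp add: mult_left_le_one_le)
    finally show "norm z \<le> (\<Sum>b\<in>B. norm b)" .
  qed
  moreover have "\<exists>!l. l \<in> \<Gamma> \<and> z - l \<in> D" for z
  proof (rule ex1I)
    have rd: "r (z - (\<Sum>b\<in>B. c b *\<^sub>R b)) b = r z b - c b" if "b \<in> B" for c b
      using linear_diff[OF bounded_linear.linear[OF B(2)[OF that]]] r[OF that, of c] by simp
    let ?l = "\<Sum>b\<in>B. real_of_int \<lfloor>r z b\<rfloor> *\<^sub>R b"
    show "?l \<in> \<Gamma> \<and> z - ?l \<in> D"
      unfolding G D_def by (auto simp: rd) linarith
    fix l assume l: "l \<in> \<Gamma> \<and> z - l \<in> D"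
    then obtain c where c: "l = (\<Sum>b\<in>B. real_of_int (c b) *\<^sub>R b)"
      unfolding G by auto
    have "\<lfloor>r z b\<rfloor> = c b" if "b \<in> B" for b
      using l that unfolding D_def c by (auto simp: rd floor_eq_iff)
    then show "l = ?l"
      unfolding c by (intro sum.cong) auto
  qed
  ultimately show thesis
    using that by blast
qed

text \<open>Lattice sums are kept as infinite sums over the fixed index set \<open>\<Gamma>\<close>,
  so that shifts are reindexings. Bounded support makes all of them summable.\<close>

lemma is_lattice_infsum_finite_support:
  fixes \<Gamma> :: "'a::euclidean_space set" and G :: "'a \<Rightarrow> 'b::{comm_monoid_add, t2_space}"
  assumes "is_lattice \<Gamma>" "bounded {z. G z \<noteq> 0}"
  shows "finite {l \<in> \<Gamma>. G (z + l) \<noteq> 0}"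
proof -
  have "bounded ((\<lambda>w. - z + w) ` {z. G z \<noteq> 0})"
    using assms(2) by (rule bounded_translation)
  then have "finite (\<Gamma> \<inter> (\<lambda>w. - z + w) ` {z. G z \<noteq> 0})"
    by (rule is_lattice_finite_Int_bounded[OF assms(1)])
  then show ?thesis
    by (rule rev_finite_subset) (auto simp: image_iff intro!: exI[of _ "z + _"])
qed

section \<open>Periodization over a fundamental domain\<close>

lemma is_lattice_infsum_shift:
  fixes \<Gamma> :: "'a::euclidean_space set" and G :: "'a \<Rightarrow> 'b::{comm_monoid_add, t2_space}"
  assumes "is_lattice \<Gamma>" "t \<in> \<Gamma>"
  shows "(\<Sum>\<^sub>\<infinity>l\<in>\<Gamma>. G (t + l)) = (\<Sum>\<^sub>\<infinity>l\<in>\<Gamma>. G l)"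
proof (rule infsum_reindex_bij_betw)
  show "bij_betw ((+) t) \<Gamma> \<Gamma>"
    by (rule bij_betw_byWitness[of _ "\<lambda>x. x - t"])
      (use is_lattice_diff[OF assms(1)] is_lattice_add[OF assms(1)] assms(2) in auto)
qed

text \<open>The lattice translates of \<open>D\<close> tile the space, so integrating the
  periodization of \<open>G\<close> over \<open>D\<close> counts each point of the space
  once.\<close>

lemma lborel_unfold_lattice:
  fixes \<Gamma> :: "'a::euclidean_space set" and G :: "'a \<Rightarrow> 'b::{banach, second_countable_topology}"
  assumes \<Gamma>: "is_lattice \<Gamma>"
    and D: "D \<in> sets borel" "bounded D" "\<And>z. \<exists>!l. l \<in> \<Gamma> \<and> z - l \<in> D"
    and G: "integrable lborel G" "bounded {z. G z \<noteq> 0}"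
  shows "integrable lborel (\<lambda>z. indicator D z *\<^sub>R (\<Sum>\<^sub>\<infinity>l\<in>\<Gamma>. G (z + l)))"
    and "integral\<^sup>L lborel (\<lambda>z. indicator D z *\<^sub>R (\<Sum>\<^sub>\<infinity>l\<in>\<Gamma>. G (z + l))) = integral\<^sup>L lborel G"
proof -
  have [measurable]: "G \<in> borel_measurable borel"
    using G(1) by auto
  have [measurable]: "D \<in> sets borel" by fact
  \<comment> \<open>Lattice vectors that carry a point of \<open>D\<close> into the support of
    \<open>G\<close>. Both sets are bounded, so on \<open>D\<close> the periodization is a sum over
    a finite set.\<close>
  define F where "F = \<Gamma> \<inter> (\<Union>w\<in>{z. G z \<noteq> 0}. \<Union>z\<in>D. {w - z})"
  have F: "finite F"
    unfolding F_def by (intro is_lattice_finite_Int_bounded bounded_differences assms)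
  have "F \<subseteq> \<Gamma>"
    unfolding F_def by blast
  have memF: "l \<in> F" if "l \<in> \<Gamma>" "w - l \<in> D" "G w \<noteq> 0" for l w
  proof -
    have "l = w - (w - l)" by simp
    then show ?thesis
      using that unfolding F_def by blast
  qed
  have eq: "indicator D z *\<^sub>R (\<Sum>\<^sub>\<infinity>l\<in>\<Gamma>. G (z + l)) = (\<Sum>l\<in>F. indicator D z *\<^sub>R G (z + l))" for z
  proof (cases "z \<in> D")
    case True
    have "(\<Sum>\<^sub>\<infinity>l\<in>\<Gamma>. G (z + l)) = (\<Sum>\<^sub>\<infinity>l\<in>F. G (z + l))"
    proof (rule infsum_cong_neutral)
      fix l assume "l \<in> \<Gamma> - F"
      then show "G (z + l) = 0"
        using memF[of l "z + l"] True by auto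
    qed (use \<open>F \<subseteq> \<Gamma>\<close> in auto)
    then show ?thesis
      using True F by simp
  qed simp
  have int1: "integrable lborel (\<lambda>w. indicator D (w - l) *\<^sub>R G w)" for l
    by (rule Bochner_Integration.integrable_bound[OF G(1)]) (auto simp: indicator_def)
  have int2: "integrable lborel (\<lambda>z. indicator D z *\<^sub>R G (z + l))"
    and int3: "integral\<^sup>L lborel (\<lambda>z. indicator D z *\<^sub>R G (z + l))
      = integral\<^sup>L lborel (\<lambda>w. indicator D (w - l) *\<^sub>R G w)" for l
  proof -
    have *: "(\<lambda>z. indicator D z *\<^sub>R G (z + l)) = (\<lambda>z. (\<lambda>w. indicator D (w - l) *\<^sub>R G w) (l + z))"
      by (simp add: add.commute)
    show "integrable lborel (\<lambda>z. indicator D z *\<^sub>R G (z + l))"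
      unfolding * by (rule integrable_distr[of "(+) l" lborel borel]) (simp_all add: lborel_distr_plus int1)
    have "integral\<^sup>L (distr lborel borel ((+) l)) (\<lambda>w. indicator D (w - l) *\<^sub>R G w)
        = integral\<^sup>L lborel (\<lambda>z. (\<lambda>w. indicator D (w - l) *\<^sub>R G w) (l + z))"
      by (rule integral_distr) auto
    then show "integral\<^sup>L lborel (\<lambda>z. indicator D z *\<^sub>R G (z + l))
      = integral\<^sup>L lborel (\<lambda>w. indicator D (w - l) *\<^sub>R G w)"
      unfolding * lborel_distr_plus by simp
  qed
  show "integrable lborel (\<lambda>z. indicator D z *\<^sub>R (\<Sum>\<^sub>\<infinity>l\<in>\<Gamma>. G (z + l)))"
    unfolding eq by (intro Bochner_Integration.integrable_sum int2)
  have "integral\<^sup>L lborel (\<lambda>z. indicator D z *\<^sub>R (\<Sum>\<^sub>\<infinity>l\<in>\<Gamma>. G (z + l)))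
      = (\<Sum>l\<in>F. integral\<^sup>L lborel (\<lambda>w. indicator D (w - l) *\<^sub>R G w))"
    unfolding eq int3[symmetric] by (rule Bochner_Integration.integral_sum) (rule int2)
  also have "\<dots> = integral\<^sup>L lborel (\<lambda>w. \<Sum>l\<in>F. indicator D (w - l) *\<^sub>R G w)"
    by (rule Bochner_Integration.integral_sum[symmetric]) (rule int1)
  also have "\<dots> = integral\<^sup>L lborel G"
  proof (rule Bochner_Integration.integral_cong[OF refl])
    fix w :: 'a
    show "(\<Sum>l\<in>F. indicator D (w - l) *\<^sub>R G w) = G w"
    proof (cases "G w = 0")
      case False
      \<comment> \<open>\<open>w\<close> lies in exactly one tile \<open>l + D\<close>, so a single
        term survives.\<close>
      obtain l where l: "l \<in> \<Gamma>" "w - l \<in> D" and u: "\<And>l'. l' \<in> \<Gamma> \<Longrightarrow> w - l' \<in> D \<Longrightarrow> l' = l"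
        using D(3)[of w] by blast
      have "l \<in> F"
        using memF[OF l(1,2)] False by simp
      have "(\<Sum>l\<in>F. indicator D (w - l) *\<^sub>R G w) = (\<Sum>l'\<in>F. if l' = l then G w else 0)"
      proof (rule sum.cong[OF refl])
        fix l' assume "l' \<in> F"
        then show "indicator D (w - l') *\<^sub>R G w = (if l' = l then G w else 0)"
          using l(2) u[of l'] \<open>F \<subseteq> \<Gamma>\<close> by (cases "l' = l") (auto simp: indicator_def)
      qed
      then show ?thesis
        using \<open>l \<in> F\<close> F by simp
    qed simp
  qed
  finally show "integral\<^sup>L lborel (\<lambda>z. indicator D z *\<^sub>R (\<Sum>\<^sub>\<infinity>l\<in>\<Gamma>. G (z + l))) = integral\<^sup>L lborel G" .
qed

lemma integrable_indicator_bounded: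
  fixes S :: "'a::euclidean_space set"
  assumes "S \<in> sets borel" "bounded S"
  shows "integrable lborel (indicator S :: 'a \<Rightarrow> real)"
  using assms emeasure_bounded_finite[OF assms(2)] by (intro integrable_real_indicator) (auto simp: less_top)

text \<open>The constant lattice sum of \<open>K\<close> is averaged over \<open>z\<close> in
  \<open>D\<close>. The vector \<open>t\<close> may depend on \<open>z\<close> in any way, because
  the periodization of \<open>E\<close> does not change under lattice shifts; no measurable choice
  is required.\<close>

lemma lattice_sum_le_integral:
  fixes \<Gamma> :: "'a::euclidean_space set" and K E :: "'a \<Rightarrow> real"
  assumes \<Gamma>: "is_lattice \<Gamma>"
    and D: "D \<in> sets borel" "bounded D" "\<And>z. \<exists>!l. l \<in> \<Gamma> \<and> z - l \<in> D"
    and K: "bounded {z. K z \<noteq> 0}"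
    and E: "integrable lborel E" "bounded {z. E z \<noteq> 0}"
    and le: "\<And>z. z \<in> D \<Longrightarrow> \<exists>t\<in>\<Gamma>. \<forall>a. K a \<le> E (a + (z - t))"
  shows "measure lborel D * (\<Sum>\<^sub>\<infinity>l\<in>\<Gamma>. K l) \<le> integral\<^sup>L lborel E"
proof -
  have summ: "(\<lambda>l. F (z + l)) summable_on \<Gamma>" if "bounded {z. F z \<noteq> 0}" for F :: "'a \<Rightarrow> real" and z
    by (rule finite_nonzero_values_imp_summable_on) (rule is_lattice_infsum_finite_support[OF \<Gamma> that])
  have *: "(\<Sum>\<^sub>\<infinity>l\<in>\<Gamma>. K l) \<le> (\<Sum>\<^sub>\<infinity>l\<in>\<Gamma>. E (z + l))" if z: "z \<in> D" for z
  proof -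
    obtain t where t: "t \<in> \<Gamma>" "\<And>a. K a \<le> E (a + (z - t))"
      using le[OF z] by blast
    have "(\<Sum>\<^sub>\<infinity>l\<in>\<Gamma>. K l) \<le> (\<Sum>\<^sub>\<infinity>l\<in>\<Gamma>. E ((z - t) + l))"
      using summ[OF K, of 0] summ[OF E(2), of "z - t"] t(2)
      by (intro infsum_mono) (auto simp: add.commute)
    also have "\<dots> = (\<Sum>\<^sub>\<infinity>l\<in>\<Gamma>. (\<lambda>l. E (z + l)) (- t + l))"
      by (simp add: algebra_simps)
    also have "\<dots> = (\<Sum>\<^sub>\<infinity>l\<in>\<Gamma>. E (z + l))"
      by (rule is_lattice_infsum_shift[OF \<Gamma> is_lattice_minus[OF \<Gamma> t(1)]])
    finally show ?thesis .
  qed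
  have Dfin: "emeasure lborel D < \<infinity>"
    using emeasure_bounded_finite[OF D(2)] by (simp add: less_top)
  have "measure lborel D * (\<Sum>\<^sub>\<infinity>l\<in>\<Gamma>. K l) = integral\<^sup>L lborel (\<lambda>z. indicator D z *\<^sub>R (\<Sum>\<^sub>\<infinity>l\<in>\<Gamma>. K l))"
    using D(1) Dfin by simp
  also have "\<dots> \<le> integral\<^sup>L lborel (\<lambda>z. indicator D z *\<^sub>R (\<Sum>\<^sub>\<infinity>l\<in>\<Gamma>. E (z + l)))"
  proof (rule integral_mono)
    show "integrable lborel (\<lambda>z. indicator D z *\<^sub>R (\<Sum>\<^sub>\<infinity>l\<in>\<Gamma>. K l))"
      by (intro integrable_scaleR_left integrable_indicator_bounded D)
    show "integrable lborel (\<lambda>z. indicator D z *\<^sub>R (\<Sum>\<^sub>\<infinity>l\<in>\<Gamma>. E (z + l)))"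
      by (rule lborel_unfold_lattice(1)[OF \<Gamma> D E])
  qed (use * in \<open>auto simp: indicator_def\<close>)
  also have "\<dots> = integral\<^sup>L lborel E"
    by (rule lborel_unfold_lattice(2)[OF \<Gamma> D E])
  finally show ?thesis .
qed

text \<open>The integral of \<open>G\<close> is the integral over \<open>z\<close> in
  \<open>D\<close> of the lattice sum shifted by \<open>z\<close>. That sum equals the one shifted
  by \<open>z - t\<close>, and for a suitable \<open>t\<close> this shift is harmless;
  \<open>E\<close> majorizes what it changes.\<close>

lemma integral_minus_lattice_sum_le:
  fixes \<Gamma> :: "'a::euclidean_space set" and G :: "'a \<Rightarrow> 'b::{banach, second_countable_topology}"
    and E :: "'a \<Rightarrow> real"
  assumes \<Gamma>: "is_lattice \<Gamma>"
    and D: "D \<in> sets borel" "bounded D" "\<And>z. \<exists>!l. l \<in> \<Gamma> \<and> z - l \<in> D"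
    and G: "integrable lborel G" "bounded {z. G z \<noteq> 0}"
    and E: "integrable lborel E" "bounded {z. E z \<noteq> 0}"
    and le: "\<And>z. z \<in> D \<Longrightarrow> \<exists>t\<in>\<Gamma>. \<forall>a. norm (G (a + (z - t)) - G a) \<le> E (a + (z - t))"
  shows "norm (integral\<^sup>L lborel G - measure lborel D *\<^sub>R (\<Sum>\<^sub>\<infinity>l\<in>\<Gamma>. G l)) \<le> integral\<^sup>L lborel E"
proof -
  have summ: "(\<lambda>l. F (z + l)) summable_on \<Gamma>" if "bounded {z. F z \<noteq> 0}"
    for F :: "'a \<Rightarrow> 'c::real_normed_vector" and z
    by (rule finite_nonzero_values_imp_summable_on) (rule is_lattice_infsum_finite_support[OF \<Gamma> that])
  have *: "norm ((\<Sum>\<^sub>\<infinity>l\<in>\<Gamma>. G (z + l)) - (\<Sum>\<^sub>\<infinity>l\<in>\<Gamma>. G l)) \<le> (\<Sum>\<^sub>\<infinity>l\<in>\<Gamma>. E (z + l))" if z: "z \<in> D" for z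
  proof -
    obtain t where t: "t \<in> \<Gamma>" "\<And>a. norm (G (a + (z - t)) - G a) \<le> E (a + (z - t))"
      using le[OF z] by blast
    have shift: "(\<Sum>\<^sub>\<infinity>l\<in>\<Gamma>. F ((z - t) + l)) = (\<Sum>\<^sub>\<infinity>l\<in>\<Gamma>. F (z + l))"
      for F :: "'a \<Rightarrow> 'c::{comm_monoid_add, t2_space}"
      using is_lattice_infsum_shift[OF \<Gamma> is_lattice_minus[OF \<Gamma> t(1)], of "\<lambda>l. F (z + l)"]
      by (simp add: algebra_simps)
    have "((\<lambda>l. G ((z - t) + l) - G (0 + l)) has_sum
        (\<Sum>\<^sub>\<infinity>l\<in>\<Gamma>. G ((z - t) + l)) - (\<Sum>\<^sub>\<infinity>l\<in>\<Gamma>. G (0 + l))) \<Gamma>"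
      unfolding diff_conv_add_uminus
      by (intro has_sum_add has_sum_uminus[THEN iffD2]) (simp_all only: minus_minus has_sum_infsum[OF summ[OF G(2)]])
    moreover have "((\<lambda>l. E ((z - t) + l)) has_sum (\<Sum>\<^sub>\<infinity>l\<in>\<Gamma>. E ((z - t) + l))) \<Gamma>"
      by (intro has_sum_infsum summ E)
    ultimately have "norm ((\<Sum>\<^sub>\<infinity>l\<in>\<Gamma>. G ((z - t) + l)) - (\<Sum>\<^sub>\<infinity>l\<in>\<Gamma>. G (0 + l)))
        \<le> (\<Sum>\<^sub>\<infinity>l\<in>\<Gamma>. E ((z - t) + l))"
      by (rule norm_infsum_le) (use t(2) in \<open>simp add: add.commute\<close>)
    then show ?thesis
      unfolding shift by simp
  qed
  have Dfin: "emeasure lborel D < \<infinity>"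
    using emeasure_bounded_finite[OF D(2)] by (simp add: less_top)
  have int: "integrable lborel (\<lambda>z. indicator D z *\<^sub>R (\<Sum>\<^sub>\<infinity>l\<in>\<Gamma>. G l))"
    by (intro integrable_scaleR_left integrable_indicator_bounded D)
  note intG = lborel_unfold_lattice[OF \<Gamma> D G] and intE = lborel_unfold_lattice[OF \<Gamma> D E]
  have "integral\<^sup>L lborel G - measure lborel D *\<^sub>R (\<Sum>\<^sub>\<infinity>l\<in>\<Gamma>. G l)
      = integral\<^sup>L lborel (\<lambda>z. indicator D z *\<^sub>R (\<Sum>\<^sub>\<infinity>l\<in>\<Gamma>. G (z + l)) - indicator D z *\<^sub>R (\<Sum>\<^sub>\<infinity>l\<in>\<Gamma>. G l))"
    using D(1) Dfin by (subst Bochner_Integration.integral_diff[OF intG(1) int]) (simp add: intG(2))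
  also have "norm \<dots> \<le> integral\<^sup>L lborel (\<lambda>z. indicator D z *\<^sub>R (\<Sum>\<^sub>\<infinity>l\<in>\<Gamma>. E (z + l)))"
    by (rule Bochner_Integration.integral_norm_bound_integral)
      (use * intG(1) intE(1) int in \<open>auto simp: indicator_def\<close>)
  also have "\<dots> = integral\<^sup>L lborel E"
    by (rule intE(2))
  finally show ?thesis .
qed

text \<open>If \<open>D\<close> were null, unfolding would give every integral the value 0, in
  particular the volume of the unit ball.\<close>

lemma fundamental_domain_measure_pos:
  fixes \<Gamma> :: "'a::euclidean_space set"
  assumes \<Gamma>: "is_lattice \<Gamma>"
    and D: "D \<in> sets borel" "bounded D" "\<And>z. \<exists>!l. l \<in> \<Gamma> \<and> z - l \<in> D"
  shows "0 < measure lborel D"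
proof (rule ccontr)
  assume "\<not> 0 < measure lborel D"
  then have "measure lborel D = 0"
    using measure_nonneg[of lborel D] by linarith
  then have "emeasure lborel D = 0"
    using emeasure_bounded_finite[OF D(2)] emeasure_eq_ennreal_measure[of lborel D] by (simp add: less_top)
  then have D0: "D \<in> null_sets lborel"
    using D(1) by auto
  define G :: "'a \<Rightarrow> real" where "G = indicator (cball 0 1)"
  have G: "integrable lborel G" "bounded {z. G z \<noteq> 0}"
    unfolding G_def by (simp add: integrable_indicator_bounded)
      (rule bounded_subset[OF bounded_cball[of 0 1]], auto simp: indicator_def)
  have "integral\<^sup>L lborel (\<lambda>z. indicator D z *\<^sub>R (\<Sum>\<^sub>\<infinity>l\<in>\<Gamma>. G (z + l))) = 0"
    by (rule integral_eq_zero_AE) (use AE_not_in[OF D0] in \<open>auto elim!: eventually_mono\<close>)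
  then have "measure lborel (cball (0::'a) 1) = 0"
    unfolding lborel_unfold_lattice(2)[OF \<Gamma> D G] by (simp add: G_def)
  then show False
    by simp
qed

text \<open>By compactness finitely many lattice points come within \<epsilon> of all internal
  coordinates of \<open>D\<close>. Finiteness bounds their physical parts; the bound
  \<open>R\<close> may explode as \<epsilon> shrinks, which does no harm since the radius of the
  ball grows last.\<close>

lemma cut_and_project_small_internal_shift:
  fixes Lt :: "((real^'m) \<times> (real^'n)) set"
  assumes "cut_and_project_scheme Lt" "bounded D" "0 < \<epsilon>"
  obtains R where "0 \<le> R" "\<And>z. z \<in> D \<Longrightarrow> \<exists>t\<in>Lt. norm (fst (z - t)) \<le> R \<and> norm (snd (z - t)) \<le> \<epsilon>"
proof -
  obtain r where r: "\<And>z. z \<in> D \<Longrightarrow> norm z \<le> r"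
    using assms(2) unfolding bounded_iff by auto
  have "cball 0 r \<subseteq> (\<Union>t\<in>Lt. ball (snd t) \<epsilon>)"
  proof
    fix y :: "real^'n"
    have "y \<in> closure (snd ` Lt)"
      using assms(1) unfolding cut_and_project_scheme_def by simp
    then obtain t where "t \<in> Lt" "dist (snd t) y < \<epsilon>"
      using assms(3) unfolding closure_approachable by blast
    then show "y \<in> (\<Union>t\<in>Lt. ball (snd t) \<epsilon>)"
      by auto
  qed
  then obtain F where F: "F \<subseteq> Lt" "finite F" "cball 0 r \<subseteq> (\<Union>t\<in>F. ball (snd t) \<epsilon>)"
    by (rule compactE_image[OF compact_cball, rotated]) auto
  have "\<exists>t\<in>Lt. norm (fst (z - t)) \<le> r + (\<Sum>t\<in>F. norm t) \<and> norm (snd (z - t)) \<le> \<epsilon>"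
    if z: "z \<in> D" for z
  proof -
    have "norm (snd z) \<le> r"
      using r[OF z] norm_snd_le[of "snd z" "fst z"] unfolding prod.collapse by simp
    then obtain t where t: "t \<in> F" "dist (snd t) (snd z) < \<epsilon>"
      using F(3) by force
    have "norm t \<le> (\<Sum>t\<in>F. norm t)"
      using t(1) F(2) by (intro member_le_sum) auto
    moreover have "norm (fst (z - t)) \<le> norm z + norm t"
      using norm_fst_le[of "fst (z - t)" "snd (z - t)"] norm_triangle_ineq4[of z t]
      unfolding prod.collapse by linarith
    ultimately show ?thesis
      using t r[OF z] F(1) by (intro bexI[of _ t]) (auto simp: dist_norm norm_minus_commute)
  qed
  \<comment> \<open>\<open>r\<close> may be negative when \<open>D\<close> is empty, hence the
    maximum.\<close>
  moreover have "0 \<le> max 0 (r + (\<Sum>t\<in>F. norm t))" by simp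
  ultimately show thesis
    using that by (metis max.coboundedI2)
qed

text \<open>Riemann integrability, stated through integrable bounds \<open>e\<close> of the oscillation at scale \<open>\<epsilon>\<close>.\<close>

definition riemann_controlled :: "('a::euclidean_space \<Rightarrow> complex) \<Rightarrow> bool" where
  "riemann_controlled \<Phi> \<longleftrightarrow>
     \<Phi> \<in> borel_measurable borel \<and> bounded (range \<Phi>) \<and> bounded {y. \<Phi> y \<noteq> 0} \<and>
     (\<forall>\<eta>>0. \<exists>\<epsilon>>0. \<exists>e. integrable lborel e \<and> bounded {y. e y \<noteq> 0} \<and> (\<forall>y. 0 \<le> e y) \<and>
        integral\<^sup>L lborel e < \<eta> \<and> (\<forall>y y'. dist y y' \<le> \<epsilon> \<longrightarrow> norm (\<Phi> y - \<Phi> y') \<le> e y))"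

lemma riemann_controlled_integrable:
  assumes "riemann_controlled \<Phi>"
  shows "integrable lborel \<Phi>"
proof -
  obtain B where B: "\<And>y. norm (\<Phi> y) \<le> B"
    using assms unfolding riemann_controlled_def bounded_iff by auto
  obtain r where r: "{y. \<Phi> y \<noteq> 0} \<subseteq> cball 0 r"
    using assms unfolding riemann_controlled_def bounded_iff by (auto simp: subset_iff)
  have [measurable]: "\<Phi> \<in> borel_measurable borel" "cball 0 r \<in> sets (borel :: 'a measure)"
    using assms unfolding riemann_controlled_def by auto
  have "(\<lambda>y. indicator (cball 0 r) y *\<^sub>R \<Phi> y) \<in> borel_measurable borel"
    by measurable
  have "integrable lborel (\<lambda>y. indicator (cball 0 r) y *\<^sub>R \<Phi> y)"
  proof (rule Bochner_Integration.integrable_bound)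
    show "integrable lborel (\<lambda>y::'a. B * indicator (cball 0 r) y)"
      by (intro integrable_mult_right integrable_indicator_bounded) auto
    show "AE y in lborel. norm (indicator (cball 0 r) y *\<^sub>R \<Phi> y) \<le> norm (B * indicator (cball 0 r) y)"
      using order_trans[OF B abs_ge_self] by (intro AE_I2) (simp add: indicator_def)
  qed (use \<open>(\<lambda>y. indicator (cball 0 r) y *\<^sub>R \<Phi> y) \<in> borel_measurable borel\<close> in simp)
  moreover have "(\<lambda>y. indicator (cball 0 r) y *\<^sub>R \<Phi> y) = \<Phi>"
    using r by (auto simp: indicator_def fun_eq_iff)
  ultimately show ?thesis by simp
qed

lemma lborel_product_scaleR:
  fixes f :: "'a::euclidean_space \<Rightarrow> real" and g :: "'b::euclidean_space \<Rightarrow> 'c::{banach, second_countable_topology}"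
  assumes "integrable lborel f" "integrable lborel g"
  shows "integrable lborel (\<lambda>z. f (fst z) *\<^sub>R g (snd z))"
    and "integral\<^sup>L lborel (\<lambda>z. f (fst z) *\<^sub>R g (snd z)) = integral\<^sup>L lborel f *\<^sub>R integral\<^sup>L lborel g"
proof -
  have [measurable]: "f \<in> borel_measurable borel" "g \<in> borel_measurable borel"
    using assms by auto
  have m: "(\<lambda>z. f (fst z) *\<^sub>R g (snd z)) \<in> borel_measurable (lborel \<Otimes>\<^sub>M lborel)"
    by measurable
  have *: "integrable (lborel \<Otimes>\<^sub>M lborel) (\<lambda>(x, y). f x *\<^sub>R g y)"
  proof (rule lborel_pair.Fubini_integrable)
    show "(\<lambda>(x, y). f x *\<^sub>R g y) \<in> borel_measurable (lborel \<Otimes>\<^sub>M lborel)"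
      using m by (simp add: case_prod_unfold)
    show "integrable lborel (\<lambda>x. LBINT y. norm (case (x, y) of (x, y) \<Rightarrow> f x *\<^sub>R g y))"
      using assms by (simp add: integrable_mult_left)
    show "AE x in lborel. integrable lborel (\<lambda>y. case (x, y) of (x, y) \<Rightarrow> f x *\<^sub>R g y)"
      using assms(2) by simp
  qed
  then show "integrable lborel (\<lambda>z. f (fst z) *\<^sub>R g (snd z))"
    by (simp add: lborel_prod case_prod_unfold)
  have "integral\<^sup>L lborel (\<lambda>z. f (fst z) *\<^sub>R g (snd z)) = (LBINT x. LBINT y. f x *\<^sub>R g y)"
    using lborel_pair.integral_fst'[OF *] by (simp add: lborel_prod case_prod_unfold)
  also have "\<dots> = integral\<^sup>L lborel f *\<^sub>R integral\<^sup>L lborel g"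
    using assms by simp
  finally show "integral\<^sup>L lborel (\<lambda>z. f (fst z) *\<^sub>R g (snd z)) = integral\<^sup>L lborel f *\<^sub>R integral\<^sup>L lborel g" .
qed

section \<open>Equidistribution in internal space\<close>

text \<open>Its sum over the lattice is the sum of \<open>\<Phi>\<close> over the starred points of
  physical norm at most \<open>s\<close>, written as a lattice sum of one function on the product
  space.\<close>

definition truncation ::
    "real \<Rightarrow> ('b \<Rightarrow> complex) \<Rightarrow> ('a::euclidean_space) \<times> 'b::euclidean_space \<Rightarrow> complex" where
  "truncation s \<Phi> z = indicator (cball 0 s) (fst z) *\<^sub>R \<Phi> (snd z)"

text \<open>Bounds the effect on a truncation of a shift by at most \<open>R\<close> in physical space: \<open>e\<close> controls the
  oscillation in internal space, and the shell accounts for points entering or leaving the ball.\<close>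

definition truncation_error ::
    "real \<Rightarrow> ('b \<Rightarrow> real) \<Rightarrow> real \<Rightarrow> real \<Rightarrow> real \<Rightarrow> ('a::euclidean_space) \<times> 'b::euclidean_space \<Rightarrow> real" where
  "truncation_error R e M r s z =
     indicator (cball 0 (s + R)) (fst z) *\<^sub>R e (snd z) +
     indicator (cball 0 (s + R) - ball 0 (s - R)) (fst z) *\<^sub>R (M * indicator (cball 0 r) (snd z))"

lemma truncation_error_nonneg: "(\<And>y. 0 \<le> e y) \<Longrightarrow> 0 \<le> M \<Longrightarrow> 0 \<le> truncation_error R e M r s z"
  unfolding truncation_error_def by simp

text \<open>If both points lie on the same side of the sphere of radius \<open>s\<close>, only the
  oscillation of \<open>\<Phi>\<close> counts. Otherwise \<open>a\<close> lies in the shell and one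
  value of \<open>\<Phi>\<close>, bounded by \<open>M\<close>, is left over.\<close>

lemma norm_truncation_diff_le:
  fixes a b :: "'a::euclidean_space \<times> 'b::euclidean_space"
  assumes M: "\<And>y. norm (\<Phi> y) \<le> M" and supp: "{y. \<Phi> y \<noteq> 0} \<subseteq> cball 0 r"
    and e: "\<And>y y'. dist y y' \<le> \<epsilon> \<Longrightarrow> norm (\<Phi> y - \<Phi> y') \<le> e y" "\<And>y. 0 \<le> e y"
    and "0 \<le> R" and ab: "norm (fst a - fst b) \<le> R" "norm (snd a - snd b) \<le> \<epsilon>"
  shows "norm (truncation s \<Phi> a - truncation s \<Phi> b) \<le> truncation_error R e M (r + \<epsilon>) s a"
proof -
  have "0 \<le> M"
    using M[of undefined] norm_ge_zero order_trans by blast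
  have "0 \<le> \<epsilon>"
    using ab(2) norm_ge_zero order_trans by blast
  \<comment> \<open>The surviving value may be that at \<open>snd b\<close> while the bound is
    evaluated at \<open>snd a\<close>; this is why the radius is enlarged by \<epsilon>.\<close>
  have mixed: "norm (\<Phi> y) \<le> M * indicator (cball 0 (r + \<epsilon>)) (snd a)"
    if "y = snd a \<or> y = snd b" for y
  proof (cases "\<Phi> y = 0")
    case False
    then have "norm y \<le> r"
      using supp by auto
    then have "norm (snd a) \<le> r + \<epsilon>"
      using that ab(2) \<open>0 \<le> \<epsilon>\<close> norm_triangle_sub[of "snd a" "snd b"] by auto
    then show ?thesis
      using M by simp
  qed (use \<open>0 \<le> M\<close> in simp)
  consider "norm (fst a) \<le> s" "norm (fst b) \<le> s" | "norm (fst a) > s" "norm (fst b) > s"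
    | "norm (fst a) \<le> s" "norm (fst b) > s" | "norm (fst a) > s" "norm (fst b) \<le> s"
    by linarith
  then show ?thesis
  proof cases
    case 1
    then show ?thesis
      using e(1)[of "snd a" "snd b"] ab \<open>0 \<le> R\<close> \<open>0 \<le> M\<close>
      by (auto simp: truncation_def truncation_error_def dist_norm intro: add_increasing2)
  next
    case 2
    then show ?thesis
      using truncation_error_nonneg[OF e(2) \<open>0 \<le> M\<close>] by (simp add: truncation_def)
  next
    case 3
    then have "norm (fst a) > s - R"
      using ab norm_triangle_sub[of "fst b" "fst a"] by (simp add: norm_minus_commute)
    then have "truncation_error R e M (r + \<epsilon>) s a = e (snd a) + M * indicator (cball 0 (r + \<epsilon>)) (snd a)"
      using 3 \<open>0 \<le> R\<close> by (simp add: truncation_error_def)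
    then show ?thesis
      using 3 mixed[of "snd a"] e(2)[of "snd a"] by (simp add: truncation_def)
  next
    case 4
    then have "norm (fst a) \<le> s + R"
      using ab norm_triangle_sub[of "fst a" "fst b"] by simp
    then have "truncation_error R e M (r + \<epsilon>) s a = e (snd a) + M * indicator (cball 0 (r + \<epsilon>)) (snd a)"
      using 4 \<open>0 \<le> R\<close> by (simp add: truncation_error_def)
    then show ?thesis
      using 4 mixed[of "snd b"] e(2)[of "snd a"] by (simp add: truncation_def)
  qed
qed

text \<open>Volumes grow like a power of the radius, so a shell of fixed width is negligible. This
  is the only asymptotic fact about physical space that is used.\<close>

lemma content_cball_ratio_tendsto:
  "((\<lambda>s. measure lborel (cball (0::'a::euclidean_space) (s + c)) / measure lborel (cball (0::'a) s)) \<longlongrightarrow> 1) at_top"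
proof -
  have "((\<lambda>s. (1 + c / s) ^ DIM('a)) \<longlongrightarrow> (1 + 0) ^ DIM('a)) at_top"
    by (intro tendsto_intros tendsto_divide_0[OF tendsto_const] filterlim_at_top_imp_at_infinity filterlim_ident)
  moreover have "\<forall>\<^sub>F s in at_top. (1 + c / s) ^ DIM('a)
      = measure lborel (cball (0::'a) (s + c)) / measure lborel (cball (0::'a) s)"
    using eventually_gt_at_top[of 0] eventually_ge_at_top[of "- c"]
  proof eventually_elim
    case (elim s)
    then have "1 + c / s = (s + c) / s"
      by (simp add: field_simps)
    moreover have "unit_ball_vol (real DIM('a)) \<noteq> 0"
      by (metis less_irrefl of_nat_0_le_iff unit_ball_vol_pos)
    ultimately show ?case
      using elim by (simp add: content_cball power_divide)
  qed
  ultimately show ?thesis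
    using Lim_transform_eventually by fastforce
qed

lemma truncation_integrable:
  assumes "integrable lborel \<Phi>"
  shows "integrable lborel (truncation s \<Phi> :: 'a::euclidean_space \<times> 'b::euclidean_space \<Rightarrow> complex)"
    and "integral\<^sup>L lborel (truncation s \<Phi> :: 'a \<times> 'b \<Rightarrow> complex)
      = measure lborel (cball (0::'a) s) *\<^sub>R integral\<^sup>L lborel \<Phi>"
  using lborel_product_scaleR[OF integrable_indicator_bounded[OF _ bounded_cball[of "0::'a" s]] assms]
  unfolding truncation_def[abs_def] by simp_all

lemma bounded_support_fst_snd:
  assumes "bounded S" "bounded T" "\<And>z. F z \<noteq> 0 \<Longrightarrow> fst z \<in> S \<and> snd z \<in> T"
  shows "bounded {z. F z \<noteq> 0}"
  by (rule bounded_subset[OF bounded_Times[OF assms(1,2)]]) (use assms(3) in \<open>auto simp: mem_Times_iff\<close>)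

text \<open>Relative to the ball, the shell term disappears and the factor of \<open>e\<close> tends
  to 1; only the oscillation in internal space remains.\<close>

lemma truncation_error_integrable:
  fixes e :: "'b::euclidean_space \<Rightarrow> real"
  assumes e: "integrable lborel e" and "0 \<le> R"
  shows "integrable lborel (truncation_error R e M r s :: 'a::euclidean_space \<times> 'b \<Rightarrow> real)" (is ?int)
    and "((\<lambda>s. integral\<^sup>L lborel (truncation_error R e M r s :: 'a \<times> 'b \<Rightarrow> real) / measure lborel (cball (0::'a) s))
      \<longlongrightarrow> integral\<^sup>L lborel e) at_top" (is ?lim)
proof -
  let ?V = "\<lambda>s. measure lborel (cball (0::'a) s)"
  let ?S = "\<lambda>s. cball 0 (s + R) - ball (0::'a) (s - R)"
  let ?K = "measure lborel (cball (0::'b) r)"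
  have S: "?S s \<in> sets borel" "bounded (?S s)" for s
    by (auto intro: bounded_subset[OF bounded_cball])
  have i1: "integrable lborel (indicator (?S s) :: 'a \<Rightarrow> real)" for s
    by (rule integrable_indicator_bounded[OF S])
  have i2: "integrable lborel (indicator (cball 0 s) :: 'a \<Rightarrow> real)" for s
    by (rule integrable_indicator_bounded) auto
  have i3: "integrable lborel (\<lambda>y::'b. M * indicator (cball 0 r) y)"
    by (intro integrable_mult_right integrable_indicator_bounded) auto
  note p1 = lborel_product_scaleR[OF i2 e] and p2 = lborel_product_scaleR[OF i1 i3]
  show ?int
    unfolding truncation_error_def[abs_def] by (intro Bochner_Integration.integrable_add p1 p2)
  have shell: "measure lborel (?S s) = ?V (s + R) - ?V (s - R)" for s
  proof -
    have "measure lborel (?S s) = ?V (s + R) - measure lborel (ball (0::'a) (s - R))"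
      by (rule measure_Diff) (use \<open>0 \<le> R\<close> emeasure_bounded_finite[OF bounded_cball] in \<open>auto simp: less_top\<close>)
    then show ?thesis
      by (simp add: content_cball_conv_ball)
  qed
  have "integral\<^sup>L lborel (truncation_error R e M r s :: 'a \<times> 'b \<Rightarrow> real)
      = ?V (s + R) * integral\<^sup>L lborel e + (?V (s + R) - ?V (s - R)) * (M * ?K)" for s
    unfolding truncation_error_def[abs_def]
    by (subst Bochner_Integration.integral_add[OF p1(1) p2(1)], subst p1(2), subst p2(2)) (simp add: shell)
  then have eq: "integral\<^sup>L lborel (truncation_error R e M r s :: 'a \<times> 'b \<Rightarrow> real) / ?V s
      = ?V (s + R) / ?V s * integral\<^sup>L lborel e + (?V (s + R) / ?V s - ?V (s + (- R)) / ?V s) * (M * ?K)" for s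
    by (simp add: add_divide_distrib diff_divide_distrib left_diff_distrib)
  have "((\<lambda>s. ?V (s + R) / ?V s * integral\<^sup>L lborel e + (?V (s + R) / ?V s - ?V (s + (- R)) / ?V s) * (M * ?K))
      \<longlongrightarrow> 1 * integral\<^sup>L lborel e + (1 - 1) * (M * ?K)) at_top"
    by (intro tendsto_intros content_cball_ratio_tendsto)
  then show ?lim
    unfolding eq by simp
qed

lemma truncation_bounded_support:
  fixes \<Phi> :: "'b::euclidean_space \<Rightarrow> complex"
  assumes "bounded {y. \<Phi> y \<noteq> 0}"
  shows "bounded {z :: 'a::euclidean_space \<times> 'b. truncation s \<Phi> z \<noteq> 0}"
  by (rule bounded_support_fst_snd[OF bounded_cball[of 0 s] assms]) (auto simp: truncation_def indicator_def split: if_splits)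

lemma truncation_error_bounded_support:
  fixes e :: "'b::euclidean_space \<Rightarrow> real"
  assumes "bounded {y. e y \<noteq> 0}"
  shows "bounded {z :: 'a::euclidean_space \<times> 'b. truncation_error R e M r s z \<noteq> 0}"
  by (rule bounded_support_fst_snd[OF bounded_cball[of 0 "s + R"] bounded_Un[THEN iffD2, OF conjI[OF assms bounded_cball[of 0 r]]]])
    (auto simp: truncation_error_def indicator_def of_bool_def split: if_splits)

lemma riemann_controlledE:
  assumes "riemann_controlled \<Phi>"
  obtains M r where "0 \<le> M" "\<And>y. norm (\<Phi> y) \<le> M" "{y. \<Phi> y \<noteq> 0} \<subseteq> cball 0 r"
    "\<And>\<eta>. 0 < \<eta> \<Longrightarrow> \<exists>\<epsilon>>0. \<exists>e. integrable lborel e \<and> bounded {y. e y \<noteq> 0} \<and> (\<forall>y. 0 \<le> e y) \<and>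
        integral\<^sup>L lborel e < \<eta> \<and> (\<forall>y y'. dist y y' \<le> \<epsilon> \<longrightarrow> norm (\<Phi> y - \<Phi> y') \<le> e y)"
proof -
  obtain M where M: "\<And>y. norm (\<Phi> y) \<le> M"
    using assms unfolding riemann_controlled_def bounded_iff by auto
  have "0 \<le> M"
    using M[of undefined] norm_ge_zero order_trans by blast
  obtain r where r: "{y. \<Phi> y \<noteq> 0} \<subseteq> cball 0 r"
    using assms unfolding riemann_controlled_def bounded_iff by (auto simp: subset_iff)
  show thesis
    by (rule that[OF \<open>0 \<le> M\<close> M r]) (use assms in \<open>auto simp: riemann_controlled_def\<close>)
qed

text \<open>The choices are made in the order \<eta>, then \<epsilon> and \<open>e\<close>, then
  \<open>R\<close>, and only then \<open>s\<close>. The relative error tends to the integral of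
  \<open>e\<close>, which lies below \<eta>.\<close>

lemma truncation_equidistribution:
  fixes Lt :: "((real^'m) \<times> (real^'n)) set"
  assumes cps: "cut_and_project_scheme Lt"
    and D: "D \<in> sets borel" "bounded D" "\<And>z. \<exists>!l. l \<in> Lt \<and> z - l \<in> D"
    and \<Phi>: "riemann_controlled \<Phi>"
  shows "((\<lambda>s. (\<Sum>\<^sub>\<infinity>l\<in>Lt. truncation s \<Phi> l) /\<^sub>R measure lborel (cball (0::real^'m) s))
    \<longlongrightarrow> integral\<^sup>L lborel \<Phi> /\<^sub>R measure lborel D) at_top"
proof -
  let ?V = "\<lambda>s. measure lborel (cball (0::real^'m) s)"
  have lat: "is_lattice Lt"
    using cps unfolding cut_and_project_scheme_def by blast
  have v: "0 < measure lborel D"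
    by (rule fundamental_domain_measure_pos[OF lat D])
  obtain M r where M: "0 \<le> M" "\<And>y. norm (\<Phi> y) \<le> M" and r: "{y. \<Phi> y \<noteq> 0} \<subseteq> cball 0 r"
    and osc: "\<And>\<eta>. 0 < \<eta> \<Longrightarrow> \<exists>\<epsilon>>0. \<exists>e. integrable lborel e \<and> bounded {y. e y \<noteq> 0} \<and> (\<forall>y. 0 \<le> e y) \<and>
        integral\<^sup>L lborel e < \<eta> \<and> (\<forall>y y'. dist y y' \<le> \<epsilon> \<longrightarrow> norm (\<Phi> y - \<Phi> y') \<le> e y)"
    using riemann_controlledE[OF \<Phi>] by blast
  note int\<Phi> = riemann_controlled_integrable[OF \<Phi>]
  have "((\<lambda>s. measure lborel D *\<^sub>R ((\<Sum>\<^sub>\<infinity>l\<in>Lt. truncation s \<Phi> l) /\<^sub>R ?V s)) \<longlongrightarrow> integral\<^sup>L lborel \<Phi>) at_top"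
  proof (rule tendstoI)
    fix \<eta> :: real assume "0 < \<eta>"
    then obtain \<epsilon> e where "0 < \<epsilon>" and e: "integrable lborel e" "bounded {y. e y \<noteq> 0}" "\<And>y. 0 \<le> e y"
      "integral\<^sup>L lborel e < \<eta>" "\<And>y y'. dist y y' \<le> \<epsilon> \<Longrightarrow> norm (\<Phi> y - \<Phi> y') \<le> e y"
      using osc by blast
    obtain R where R: "0 \<le> R" "\<And>z. z \<in> D \<Longrightarrow> \<exists>t\<in>Lt. norm (fst (z - t)) \<le> R \<and> norm (snd (z - t)) \<le> \<epsilon>"
      using cut_and_project_small_internal_shift[OF cps D(2) \<open>0 < \<epsilon>\<close>] by blast
    let ?E = "\<lambda>s. truncation_error R e M (r + \<epsilon>) s :: (real^'m) \<times> (real^'n) \<Rightarrow> real"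
    have "norm (integral\<^sup>L lborel (truncation s \<Phi> :: (real^'m) \<times> (real^'n) \<Rightarrow> complex)
        - measure lborel D *\<^sub>R (\<Sum>\<^sub>\<infinity>l\<in>Lt. truncation s \<Phi> l)) \<le> integral\<^sup>L lborel (?E s)" for s
    proof (rule integral_minus_lattice_sum_le[OF lat D])
      fix z assume "z \<in> D"
      then obtain t where t: "t \<in> Lt" "norm (fst (z - t)) \<le> R" "norm (snd (z - t)) \<le> \<epsilon>"
        using R(2) by blast
      show "\<exists>t\<in>Lt. \<forall>a. norm (truncation s \<Phi> (a + (z - t)) - truncation s \<Phi> a) \<le> ?E s (a + (z - t))"
        by (rule bexI[OF _ t(1)], rule allI, rule norm_truncation_diff_le[OF M(2) r e(5,3) R(1)])
          (use t in simp_all)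
    qed (intro truncation_integrable int\<Phi> truncation_error_integrable e R(1)
      truncation_bounded_support[OF bounded_subset[OF bounded_cball r]] truncation_error_bounded_support)+
    then have *: "norm (?V s *\<^sub>R integral\<^sup>L lborel \<Phi> - measure lborel D *\<^sub>R (\<Sum>\<^sub>\<infinity>l\<in>Lt. truncation s \<Phi> l))
        \<le> integral\<^sup>L lborel (?E s)" for s
      unfolding truncation_integrable(2)[OF int\<Phi>] .
    have "\<forall>\<^sub>F s in at_top. integral\<^sup>L lborel (?E s) / ?V s < \<eta>"
      by (rule order_tendstoD(2)[OF truncation_error_integrable(2)[OF e(1) R(1)] e(4)])
    then show "\<forall>\<^sub>F s in at_top. dist (measure lborel D *\<^sub>R ((\<Sum>\<^sub>\<infinity>l\<in>Lt. truncation s \<Phi> l) /\<^sub>R ?V s))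
        (integral\<^sup>L lborel \<Phi>) < \<eta>"
      using eventually_gt_at_top[of 0]
    proof eventually_elim
      case (elim s)
      have V: "0 < ?V s" using elim(2) by simp
      let ?A = "integral\<^sup>L lborel \<Phi>" and ?B = "measure lborel D *\<^sub>R (\<Sum>\<^sub>\<infinity>l\<in>Lt. truncation s \<Phi> l)"
      have "?A - ?B /\<^sub>R ?V s = (?V s *\<^sub>R ?A - ?B) /\<^sub>R ?V s"
        using V by (simp add: scaleR_diff_right)
      then have "norm (?A - ?B /\<^sub>R ?V s) = norm (?V s *\<^sub>R ?A - ?B) / ?V s"
        using V by (simp add: divide_inverse mult.commute)
      also have "\<dots> \<le> integral\<^sup>L lborel (?E s) / ?V s"
        using V *[of s] by (simp add: divide_right_mono)
      finally show ?case
        using elim(1) by (simp add: dist_norm norm_minus_commute mult.commute)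
    qed
  qed
  from tendsto_scaleR[OF tendsto_const this, of "inverse (measure lborel D)"] show ?thesis
    using v by (simp add: mult.assoc[symmetric])
qed

text \<open>Shifting the index by \<open>l0\<close> multiplies the twisted sum by
  \<open>\<xi> l0\<close>, but hardly changes the truncation when the internal part of
  \<open>l0\<close> is small. Hence \<open>1 - \<xi> l0\<close> times the sum is small relative to
  the ball, while this factor has modulus at least \<eta>.\<close>

lemma truncation_twisted_tendsto_0:
  fixes Lt :: "((real^'m) \<times> (real^'n)) set" and \<xi> :: "(real^'m) \<times> (real^'n) \<Rightarrow> complex"
  assumes cps: "cut_and_project_scheme Lt"
    and \<Phi>: "riemann_controlled \<Phi>"
    and \<xi>: "\<And>a b. \<xi> (a + b) = \<xi> a * \<xi> b" "\<And>a. norm (\<xi> a) = 1"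
    and "0 < \<eta>" and jump: "\<And>\<epsilon>. 0 < \<epsilon> \<Longrightarrow> \<exists>l\<in>Lt. norm (snd l) < \<epsilon> \<and> \<eta> \<le> norm (\<xi> l - 1)"
  shows "((\<lambda>s. (\<Sum>\<^sub>\<infinity>l\<in>Lt. truncation s \<Phi> l * \<xi> l) /\<^sub>R measure lborel (cball (0::real^'m) s)) \<longlongrightarrow> 0) at_top"
proof -
  let ?V = "\<lambda>s. measure lborel (cball (0::real^'m) s)"
  let ?S = "\<lambda>s. \<Sum>\<^sub>\<infinity>l\<in>Lt. truncation s \<Phi> l * \<xi> l"
  have lat: "is_lattice Lt"
    using cps unfolding cut_and_project_scheme_def by blast
  obtain D where D: "D \<in> sets borel" "bounded D" "\<And>z. \<exists>!l. l \<in> Lt \<and> z - l \<in> D"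
    using is_lattice_fundamental_domain[OF lat] by blast
  let ?v = "measure lborel D"
  have v: "0 < ?v"
    by (rule fundamental_domain_measure_pos[OF lat D])
  obtain M r where M: "0 \<le> M" "\<And>y. norm (\<Phi> y) \<le> M" and r: "{y. \<Phi> y \<noteq> 0} \<subseteq> cball 0 r"
    and osc: "\<And>\<eta>. 0 < \<eta> \<Longrightarrow> \<exists>\<epsilon>>0. \<exists>e. integrable lborel e \<and> bounded {y. e y \<noteq> 0} \<and> (\<forall>y. 0 \<le> e y) \<and>
        integral\<^sup>L lborel e < \<eta> \<and> (\<forall>y y'. dist y y' \<le> \<epsilon> \<longrightarrow> norm (\<Phi> y - \<Phi> y') \<le> e y)"
    using riemann_controlledE[OF \<Phi>] by blast
  have G: "bounded {z. (truncation s \<Phi> :: (real^'m) \<times> (real^'n) \<Rightarrow> complex) z \<noteq> 0}" for s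
    by (intro truncation_bounded_support bounded_subset[OF bounded_cball r])
  show ?thesis
  proof (rule tendstoI)
    fix \<delta> :: real assume "0 < \<delta>"
    \<comment> \<open>\<eta> pays for the division by \<open>1 - \<xi> l0\<close>, \<open>?v\<close>
      for the passage from sum to integral, and 2 for the two comparisons behind
      \<open>K\<close>.\<close>
    then have "0 < \<delta> * \<eta> * ?v / 2"
      using v \<open>0 < \<eta>\<close> by simp
    then obtain \<epsilon> e where "0 < \<epsilon>" and e: "integrable lborel e" "bounded {y. e y \<noteq> 0}" "\<And>y. 0 \<le> e y"
      "integral\<^sup>L lborel e < \<delta> * \<eta> * ?v / 2" "\<And>y y'. dist y y' \<le> \<epsilon> \<Longrightarrow> norm (\<Phi> y - \<Phi> y') \<le> e y"
      using osc by blast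
    \<comment> \<open>The displacement \<open>\<theta> - l0\<close> must stay within \<epsilon> in
      internal space: one half for \<open>\<theta>\<close>, one half for \<open>l0\<close>. Its
      physical part is covered by adding the length of \<open>fst l0\<close> to
      \<open>R0\<close>.\<close>
    have "0 < \<epsilon> / 2" using \<open>0 < \<epsilon>\<close> by simp
    obtain R0 where R0: "0 \<le> R0" "\<And>z. z \<in> D \<Longrightarrow> \<exists>t\<in>Lt. norm (fst (z - t)) \<le> R0 \<and> norm (snd (z - t)) \<le> \<epsilon> / 2"
      using cut_and_project_small_internal_shift[OF cps D(2) \<open>0 < \<epsilon> / 2\<close>] by blast
    obtain l0 where l0: "l0 \<in> Lt" "norm (snd l0) < \<epsilon> / 2" "\<eta> \<le> norm (\<xi> l0 - 1)"
      using jump[OF \<open>0 < \<epsilon> / 2\<close>] by blast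
    define R where "R = R0 + norm (fst l0)"
    have R: "0 \<le> R" unfolding R_def using R0(1) by simp
    let ?E = "\<lambda>s. truncation_error R e M (r + \<epsilon>) s :: (real^'m) \<times> (real^'n) \<Rightarrow> real"
    define K where "K s a = norm (truncation s \<Phi> (l0 + a) - truncation s \<Phi> a)" for s and a :: "(real^'m) \<times> (real^'n)"
    have K: "bounded {a. K s a \<noteq> 0}" for s
    proof -
      have "bounded ((\<lambda>a. - l0 + a) ` {z. (truncation s \<Phi> :: (real^'m) \<times> (real^'n) \<Rightarrow> complex) z \<noteq> 0})"
        by (rule bounded_translation[OF G])
      then have "bounded ((\<lambda>a. - l0 + a) ` {z. truncation s \<Phi> z \<noteq> 0} \<union> {z. truncation s \<Phi> z \<noteq> 0})"
        using G by simp
      moreover have "a \<in> (\<lambda>a. - l0 + a) ` {z. truncation s \<Phi> z \<noteq> 0}" if "truncation s \<Phi> (l0 + a) \<noteq> 0" for a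
        using that by (intro image_eqI[of _ _ "l0 + a"]) auto
      moreover have "truncation s \<Phi> (l0 + a) \<noteq> 0 \<or> truncation s \<Phi> a \<noteq> 0" if "K s a \<noteq> 0" for a
        using that unfolding K_def by (metis diff_self norm_zero)
      ultimately show ?thesis
        by (elim bounded_subset) blast
    qed
    have vK: "?v * (\<Sum>\<^sub>\<infinity>l\<in>Lt. K s l) \<le> 2 * integral\<^sup>L lborel (?E s)" for s
    proof -
      have "?v * (\<Sum>\<^sub>\<infinity>l\<in>Lt. K s l) \<le> integral\<^sup>L lborel (\<lambda>z. 2 * ?E s z)"
      proof (rule lattice_sum_le_integral[OF lat D K])
        show "integrable lborel (\<lambda>z. 2 * ?E s z)"
          by (intro integrable_mult_right truncation_error_integrable e R)
        show "bounded {z. 2 * ?E s z \<noteq> 0}"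
          using truncation_error_bounded_support[OF e(2), of R M "r + \<epsilon>" s] by simp
        fix z assume "z \<in> D"
        then obtain t where t: "t \<in> Lt" "norm (fst (z - t)) \<le> R0" "norm (snd (z - t)) \<le> \<epsilon> / 2"
          using R0(2) by blast
        define \<theta> where "\<theta> = z - t"
        \<comment> \<open>The values at \<open>l0 + a\<close> and at \<open>a\<close> are compared
          through the common point \<open>a + \<theta>\<close>, at which the error function is
          evaluated both times.\<close>
        have "K s a \<le> 2 * ?E s (a + \<theta>)" for a
        proof -
          have "norm (truncation s \<Phi> (a + \<theta>) - truncation s \<Phi> (l0 + a)) \<le> ?E s (a + \<theta>)"
          proof (rule norm_truncation_diff_le[OF M(2) r e(5,3) R])
            show "norm (fst (a + \<theta>) - fst (l0 + a)) \<le> R"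
              using t(2) norm_triangle_ineq4[of "fst \<theta>" "fst l0"] unfolding R_def \<theta>_def
              by (simp add: algebra_simps)
            show "norm (snd (a + \<theta>) - snd (l0 + a)) \<le> \<epsilon>"
              using t(3) l0(2) norm_triangle_ineq4[of "snd \<theta>" "snd l0"] unfolding \<theta>_def
              by (simp add: algebra_simps)
          qed
          moreover have "norm (truncation s \<Phi> (a + \<theta>) - truncation s \<Phi> a) \<le> ?E s (a + \<theta>)"
            by (rule norm_truncation_diff_le[OF M(2) r e(5,3) R])
              (use t(2,3) \<open>0 < \<epsilon>\<close> norm_ge_zero[of "fst l0"] in \<open>simp_all add: R_def \<theta>_def add_increasing2\<close>)
          ultimately show ?thesis
            using norm_triangle_ineq4[of "truncation s \<Phi> (a + \<theta>) - truncation s \<Phi> a"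
                "truncation s \<Phi> (a + \<theta>) - truncation s \<Phi> (l0 + a)"]
            by (simp add: K_def)
        qed
        then show "\<exists>t\<in>Lt. \<forall>a. K s a \<le> 2 * ?E s (a + (z - t))"
          using t(1) unfolding \<theta>_def by blast
      qed
      then show ?thesis by simp
    qed
    have SK: "\<eta> * norm (?S s) \<le> (\<Sum>\<^sub>\<infinity>l\<in>Lt. K s l)" for s
    proof -
      have sum1: "(\<lambda>l. truncation s \<Phi> l * \<xi> l) summable_on Lt"
        using is_lattice_infsum_finite_support[OF lat G[of s], of 0]
        by (intro finite_nonzero_values_imp_summable_on) (auto elim: rev_finite_subset)
      have sum2: "(\<lambda>l. truncation s \<Phi> (l0 + l) * \<xi> l) summable_on Lt"
        using is_lattice_infsum_finite_support[OF lat G[of s], of l0]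
        by (intro finite_nonzero_values_imp_summable_on) (auto elim: rev_finite_subset)
      have sumK: "K s summable_on Lt"
        using is_lattice_infsum_finite_support[OF lat K[of s], of 0]
        by (intro finite_nonzero_values_imp_summable_on) auto
      have "?S s = (\<Sum>\<^sub>\<infinity>l\<in>Lt. truncation s \<Phi> (l0 + l) * \<xi> (l0 + l))"
        by (rule is_lattice_infsum_shift[OF lat l0(1), symmetric])
      also have "\<dots> = \<xi> l0 * (\<Sum>\<^sub>\<infinity>l\<in>Lt. truncation s \<Phi> (l0 + l) * \<xi> l)"
        by (simp add: \<xi>(1) infsum_cmult_right'[symmetric] mult_ac)
      finally have "(1 - \<xi> l0) * ?S s = \<xi> l0 * ((\<Sum>\<^sub>\<infinity>l\<in>Lt. truncation s \<Phi> (l0 + l) * \<xi> l) + - ?S s)"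
        by (simp add: algebra_simps)
      then have "norm (1 - \<xi> l0) * norm (?S s)
          = norm ((\<Sum>\<^sub>\<infinity>l\<in>Lt. truncation s \<Phi> (l0 + l) * \<xi> l) + - ?S s)"
        using \<xi>(2)[of l0] by (simp add: norm_mult[symmetric]) (simp add: norm_mult)
      also have "\<dots> \<le> (\<Sum>\<^sub>\<infinity>l\<in>Lt. K s l)"
      proof (rule norm_infsum_le)
        show "((\<lambda>l. truncation s \<Phi> (l0 + l) * \<xi> l + - (truncation s \<Phi> l * \<xi> l)) has_sum
            (\<Sum>\<^sub>\<infinity>l\<in>Lt. truncation s \<Phi> (l0 + l) * \<xi> l) + - ?S s) Lt"
          by (intro has_sum_add has_sum_uminusI has_sum_infsum sum1 sum2)
        show "norm (truncation s \<Phi> (l0 + l) * \<xi> l + - (truncation s \<Phi> l * \<xi> l)) \<le> K s l" for l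
          using \<xi>(2)[of l] by (simp add: K_def norm_mult left_diff_distrib[symmetric])
      qed (rule has_sum_infsum[OF sumK])
      finally show ?thesis
        using mult_right_mono[OF l0(3) norm_ge_zero[of "?S s"]] by (simp add: norm_minus_commute)
    qed
    have "\<forall>\<^sub>F s in at_top. integral\<^sup>L lborel (?E s) / ?V s < \<delta> * \<eta> * ?v / 2"
      by (rule order_tendstoD(2)[OF truncation_error_integrable(2)[OF e(1) R] e(4)])
    then show "\<forall>\<^sub>F s in at_top. dist (?S s /\<^sub>R ?V s) 0 < \<delta>"
      using eventually_gt_at_top[of 0]
    proof eventually_elim
      case (elim s)
      have V: "0 < ?V s" using elim(2) by simp
      have "?v * \<eta> * norm (?S s) \<le> ?v * (\<Sum>\<^sub>\<infinity>l\<in>Lt. K s l)"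
        using mult_left_mono[OF SK[of s], of ?v] v by (simp add: mult.assoc)
      also have "\<dots> \<le> 2 * integral\<^sup>L lborel (?E s)" by (rule vK)
      also have "\<dots> < \<delta> * \<eta> * ?v * ?V s"
        using elim(1) V by (simp add: field_simps)
      finally have "(?v * \<eta>) * norm (?S s) < (?v * \<eta>) * (\<delta> * ?V s)"
        by (simp add: mult_ac)
      then have "norm (?S s) < \<delta> * ?V s"
        by (rule mult_left_less_imp_less) (use v \<open>0 < \<eta>\<close> in simp)
      then show ?case
        using V by (simp add: field_simps)
    qed
  qed
qed

text \<open>Two nearby points of \<open>W\<close> are handled by uniform continuity. If only one of
  them lies in \<open>W\<close>, the segment between them meets the frontier, so both are close to a
  compact null set; its small neighbourhoods have small measure.\<close>

lemma riemann_controlled_window: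
  fixes W :: "(real^'n) set" and \<phi> :: "real^'n \<Rightarrow> complex"
  assumes W: "compact W" "frontier W \<in> null_sets lebesgue" and \<phi>: "continuous_on UNIV \<phi>"
  shows "riemann_controlled (\<lambda>y. indicator W y *\<^sub>R \<phi> y)"
proof -
  have Wb: "W \<in> sets borel" "bounded W"
    using W(1) by (auto simp: borel_compact compact_imp_bounded)
  have \<phi>W: "continuous_on W \<phi>"
    using \<phi> continuous_on_subset by blast
  obtain M where M: "\<And>y. y \<in> W \<Longrightarrow> norm (\<phi> y) \<le> M" "0 < M"
    using compact_imp_bounded[OF compact_continuous_image[OF \<phi>W W(1)]] unfolding bounded_pos by auto
  obtain r where r: "W \<subseteq> cball 0 r"
    using Wb(2) unfolding bounded_iff by (auto simp: subset_iff)
  show ?thesis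
    unfolding riemann_controlled_def
  proof (intro conjI allI impI)
    have [measurable]: "\<phi> \<in> borel_measurable borel" "W \<in> sets borel"
      using \<phi> Wb by (auto intro: borel_measurable_continuous_onI)
    show "(\<lambda>y. indicator W y *\<^sub>R \<phi> y) \<in> borel_measurable borel"
      by measurable
    show "bounded (range (\<lambda>y. indicator W y *\<^sub>R \<phi> y))"
      unfolding bounded_iff using M by (auto intro!: exI[of _ M] simp: indicator_def)
    show "bounded {y. indicator W y *\<^sub>R \<phi> y \<noteq> 0}"
      by (rule bounded_subset[OF Wb(2)]) (auto simp: indicator_def split: if_splits)
  next
    fix \<eta> :: real assume "0 < \<eta>"
    let ?V = "measure lborel (cball (0::real^'n) r)"
    \<comment> \<open>Half of \<eta> goes to the interior oscillation and half to the neighbourhood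
      of the frontier. Adding 1 keeps the denominator positive even when the ball is empty.\<close>
    define \<eta>1 where "\<eta>1 = \<eta> / (2 * (?V + 1))"
    have "0 < ?V + 1"
      using measure_nonneg[of lborel "cball (0::real^'n) r"] by linarith
    then have "0 < \<eta>1"
      unfolding \<eta>1_def using \<open>0 < \<eta>\<close> by simp
    have \<eta>1V: "\<eta>1 * ?V < \<eta> / 2"
      unfolding \<eta>1_def using \<open>0 < \<eta>\<close> \<open>0 < ?V + 1\<close> by (simp add: field_simps)
    obtain d1 where d1: "0 < d1" "\<And>y y'. y \<in> W \<Longrightarrow> y' \<in> W \<Longrightarrow> dist y' y < d1 \<Longrightarrow> dist (\<phi> y') (\<phi> y) < \<eta>1"
      using compact_uniformly_continuous[OF \<phi>W W(1)] \<open>0 < \<eta>1\<close> unfolding uniformly_continuous_on_def by meson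
    have F: "bounded (frontier W)" "negligible (frontier W)" "compact (frontier W)"
      using W by (auto simp: negligible_iff_null_sets compact_frontier compact_imp_bounded)
    have FF: "negligible (frontier (frontier W))"
      using F(2) frontier_subset_closed[of "frontier W"] negligible_subset by blast
    have mF: "measure lebesgue (frontier W) = 0"
      by (rule negligible_imp_measure0[OF F(2)])
    have "0 < \<eta> / (2 * M)" using \<open>0 < \<eta>\<close> M(2) by simp
    then obtain d2 where d2: "0 < d2" "\<And>T. \<lbrakk>T \<in> lmeasurable; \<And>y. y \<in> T \<Longrightarrow> \<exists>x. x \<in> frontier W \<and> dist x y < d2\<rbrakk>
        \<Longrightarrow> measure lebesgue T < \<eta> / (2 * M)"
      using measure_semicontinuous_with_hausdist_explicit[OF F(1) FF] mF by (metis add_0)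
    \<comment> \<open>The closed \<open>d2 / 2\<close> neighbourhood, written as a sum of two
      compact sets so that it is compact; half the radius provides the strict inequality in
      \<open>d2\<close>.\<close>
    define T where "T = (\<Union>x\<in>frontier W. \<Union>y\<in>cball 0 (d2 / 2). {x + y})"
    have "compact T"
      unfolding T_def by (rule compact_sums'[OF F(3) compact_cball])
    then have Tb: "T \<in> sets borel" "bounded T"
      by (auto simp: borel_compact compact_imp_bounded)
    have memT: "y \<in> T" if "x \<in> frontier W" "dist x y \<le> d2 / 2" for x y
    proof -
      have "y = x + (y - x)" by simp
      moreover have "y - x \<in> cball 0 (d2 / 2)"
        using that(2) by (simp add: dist_norm norm_minus_commute)
      ultimately show ?thesis
        unfolding T_def using that(1) by blast
    qed
    have "measure lebesgue T < \<eta> / (2 * M)"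
    proof (rule d2(2))
      show "T \<in> lmeasurable"
        using \<open>compact T\<close> by (rule lmeasurable_compact)
      fix y assume "y \<in> T"
      then obtain x u where "x \<in> frontier W" "norm u \<le> d2 / 2" "y = x + u"
        unfolding T_def by auto
      then show "\<exists>x. x \<in> frontier W \<and> dist x y < d2"
        using d2(1) by (intro exI[of _ x]) (simp add: dist_norm)
    qed
    then have mT: "M * measure lborel T < \<eta> / 2"
      using Tb M(2) by (simp add: field_simps)
    define e where "e y = \<eta>1 * indicator (cball 0 r) y + M * indicator T y" for y
    have i1: "integrable lborel (\<lambda>y. \<eta>1 * indicator (cball 0 r) y)"
      by (intro integrable_mult_right integrable_indicator_bounded) auto
    have i2: "integrable lborel (\<lambda>y. M * indicator T y)"
      by (intro integrable_mult_right integrable_indicator_bounded Tb)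
    have "integral\<^sup>L lborel e = \<eta>1 * ?V + M * measure lborel T"
      unfolding e_def[abs_def] using Tb by (subst Bochner_Integration.integral_add[OF i1 i2]) simp
    then have int_e: "integral\<^sup>L lborel e < \<eta>"
      using \<eta>1V mT by linarith
    define \<epsilon> where "\<epsilon> = min (d1 / 2) (d2 / 2)"
    have "norm (indicator W y *\<^sub>R \<phi> y - indicator W y' *\<^sub>R \<phi> y') \<le> e y" if "dist y y' \<le> \<epsilon>" for y y'
    proof -
      have cross: "y \<in> T" if "(y \<in> W) \<noteq> (y' \<in> W)"
      proof -
        have "closed_segment y y' \<inter> frontier W \<noteq> {}"
          by (rule connected_Int_frontier) (use that in auto)
        then obtain x where x: "x \<in> closed_segment y y'" "x \<in> frontier W"
          by blast
        have "dist x y \<le> dist y y'"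
          using dist_in_closed_segment[OF x(1)] by (simp add: dist_commute)
        then show ?thesis
          using \<open>dist y y' \<le> \<epsilon>\<close> memT[OF x(2)] unfolding \<epsilon>_def by simp
      qed
      have T0: "0 \<le> M * indicator T y" "0 \<le> \<eta>1 * indicator (cball 0 r) y"
        using M(2) \<open>0 < \<eta>1\<close> by auto
      consider "y \<in> W" "y' \<in> W" | "y \<notin> W" "y' \<notin> W" | "y \<in> W" "y' \<notin> W" | "y \<notin> W" "y' \<in> W"
        by blast
      then show ?thesis
      proof cases
        case 1
        have "dist y y' < d1"
          using that d1(1) unfolding \<epsilon>_def by simp
        then have "norm (\<phi> y - \<phi> y') \<le> \<eta>1 * indicator (cball 0 r) y"
          using d1(2)[OF 1(2,1)] 1 r by (auto simp: dist_norm)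
        then show ?thesis
          using 1 T0(1) by (simp add: e_def)
      next
        case 2
        then show ?thesis
          using T0 by (simp add: e_def)
      next
        case 3
        then show ?thesis
          using cross M(1)[of y] T0(2) by (simp add: e_def)
      next
        case 4
        then show ?thesis
          using cross M(1)[of y'] T0(2) by (simp add: e_def)
      qed
    qed
    moreover have "0 < \<epsilon>"
      unfolding \<epsilon>_def using d1 d2 by simp
    moreover have "integrable lborel e"
      unfolding e_def[abs_def] by (rule Bochner_Integration.integrable_add[OF i1 i2])
    moreover have "bounded {y. e y \<noteq> 0}"
      by (rule bounded_subset[of "cball 0 r \<union> T"]) (use Tb in \<open>auto simp: e_def indicator_def\<close>)
    moreover have "0 \<le> e y" for y
      using M(2) \<open>0 < \<eta>1\<close> by (simp add: e_def)
    ultimately show "\<exists>\<epsilon>>0. \<exists>e. integrable lborel e \<and> bounded {y. e y \<noteq> 0} \<and> (\<forall>y. 0 \<le> e y) \<and>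
        integral\<^sup>L lborel e < \<eta> \<and>
        (\<forall>y y'. dist y y' \<le> \<epsilon> \<longrightarrow> norm (indicator W y *\<^sub>R \<phi> y - indicator W y' *\<^sub>R \<phi> y') \<le> e y)"
      using int_e by blast
  qed
qed

section \<open>Means over model sets\<close>

lemma character_add: "character k (x + y) = character k x * character k y"
  unfolding character_def by (simp add: inner_add_right distrib_left flip: exp_add)

lemma norm_character [simp]: "norm (character k x) = 1"
proof -
  have "character k x = exp (\<i> * complex_of_real (- 2 * pi * (k \<bullet> x)))"
    unfolding character_def by (simp add: mult_ac)
  then show ?thesis by (simp only: norm_exp_i_times)
qed

text \<open>A continuous unitary character of internal space that interpolates
  \<open>character k\<close> through the star map. Density of the projected lattice determines
  \<open>\<psi>\<close>. Only frequencies \<open>k\<close> with such a \<open>\<psi>\<close> can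
  have nonzero twisted means.\<close>

definition internal_character ::
    "((real^'m) \<times> (real^'n)) set \<Rightarrow> real^'m \<Rightarrow> (real^'n \<Rightarrow> complex) \<Rightarrow> bool" where
  "internal_character Lt k \<psi> \<longleftrightarrow> continuous_on UNIV \<psi> \<and> (\<forall>y. norm (\<psi> y) = 1) \<and>
     (\<forall>u w. \<psi> (u + w) = \<psi> u * \<psi> w) \<and> (\<forall>l\<in>Lt. character k (fst l) = \<psi> (snd l))"

text \<open>For a homomorphism, continuity at 0 is uniform continuity. The character thus extends
  from the dense projection of the lattice, and its algebraic identities pass to the
  closure.\<close>

lemma internal_character_exists:
  fixes Lt :: "((real^'m) \<times> (real^'n)) set"
  assumes cps: "cut_and_project_scheme Lt"
    and cont: "\<And>\<eta>. 0 < \<eta> \<Longrightarrow> \<exists>\<epsilon>>0. \<forall>l\<in>Lt. norm (snd l) < \<epsilon> \<longrightarrow> norm (character k (fst l) - 1) < \<eta>"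
  shows "\<exists>\<psi>. internal_character Lt k \<psi>"
proof -
  have lat: "is_lattice Lt" and dense: "closure (snd ` Lt) = UNIV"
    using cps unfolding cut_and_project_scheme_def by auto
  have near: "\<exists>\<epsilon>>0. \<forall>l\<in>Lt. \<forall>l'\<in>Lt. dist (snd l') (snd l) < \<epsilon> \<longrightarrow>
      dist (character k (fst l')) (character k (fst l)) < \<eta>" if \<eta>: "0 < \<eta>" for \<eta>
  proof -
    obtain \<epsilon> where \<epsilon>: "0 < \<epsilon>" "\<And>l. l \<in> Lt \<Longrightarrow> norm (snd l) < \<epsilon> \<Longrightarrow> norm (character k (fst l) - 1) < \<eta>"
      using cont[OF \<eta>] by blast
    have "dist (character k (fst l')) (character k (fst l)) < \<eta>"
      if "l \<in> Lt" "l' \<in> Lt" "dist (snd l') (snd l) < \<epsilon>" for l l'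
    proof -
      have "character k (fst l') = character k (fst l) * character k (fst (l' - l))"
        by (simp add: character_add[symmetric])
      then have "dist (character k (fst l')) (character k (fst l)) = norm (character k (fst l) * (character k (fst (l' - l)) - 1))"
        by (simp add: dist_norm right_diff_distrib)
      also have "\<dots> < \<eta>"
        using \<epsilon>(2)[OF is_lattice_diff[OF lat that(2,1)]] that(3) by (simp add: norm_mult dist_norm)
      finally show ?thesis .
    qed
    then show ?thesis
      using \<epsilon>(1) by blast
  qed
  \<comment> \<open>\<open>snd\<close> need not be injective on the lattice, so a preimage is
    chosen. Two lattice points with equal internal coordinate have character values closer than
    every \<eta>, hence equal, and the choice is immaterial.\<close>
  define g0 where "g0 y = character k (fst (inv_into Lt snd y))" for y
  have g0: "g0 (snd l) = character k (fst l)" if "l \<in> Lt" for l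
  proof -
    have inv: "inv_into Lt snd (snd l) \<in> Lt" "snd (inv_into Lt snd (snd l)) = snd l"
      using that by (auto intro: inv_into_into f_inv_into_f)
    have "dist (g0 (snd l)) (character k (fst l)) < \<eta>" if "0 < \<eta>" for \<eta>
      using near[OF that] \<open>l \<in> Lt\<close> inv unfolding g0_def by (metis dist_self)
    then show ?thesis
      by (metis dist_pos_lt less_irrefl)
  qed
  have "uniformly_continuous_on (snd ` Lt) g0"
    unfolding uniformly_continuous_on_def
  proof (intro allI impI)
    fix \<eta> :: real assume "0 < \<eta>"
    from near[OF this] show "\<exists>d>0. \<forall>x\<in>snd ` Lt. \<forall>x'\<in>snd ` Lt. dist x' x < d \<longrightarrow> dist (g0 x') (g0 x) < \<eta>"
      by (auto simp del: split_paired_All split_paired_Ex simp: g0)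
  qed
  then obtain \<psi> where \<psi>: "uniformly_continuous_on (closure (snd ` Lt)) \<psi>" "\<And>y. y \<in> snd ` Lt \<Longrightarrow> g0 y = \<psi> y"
    by (rule uniformly_continuous_on_extension_on_closure) blast
  have cont\<psi>: "continuous_on UNIV \<psi>"
    using \<psi>(1) uniformly_continuous_imp_continuous unfolding dense by blast
  have ext: "character k (fst l) = \<psi> (snd l)" if "l \<in> Lt" for l
    using g0[OF that] \<psi>(2)[of "snd l"] that by auto
  have "norm (\<psi> y) = 1" for y
  proof (rule continuous_constant_on_closure[of "snd ` Lt" "\<lambda>y. norm (\<psi> y)"])
    show "continuous_on (closure (snd ` Lt)) (\<lambda>y. norm (\<psi> y))"
      unfolding dense by (intro continuous_intros cont\<psi>)
    show "norm (\<psi> x) = 1" if "x \<in> snd ` Lt" for x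
      using that ext norm_character by (metis imageE)
  qed (simp add: dense)
  moreover have "\<psi> (u + w) = \<psi> u * \<psi> w" for u w
  proof -
    \<comment> \<open>Multiplicativity is the vanishing of a continuous function of two variables,
      known on a dense set of pairs.\<close>
    let ?S = "snd ` Lt \<times> snd ` Lt"
    let ?F = "\<lambda>p. \<psi> (fst p + snd p) - \<psi> (fst p) * \<psi> (snd p)"
    have cl: "closure ?S = UNIV"
      by (simp add: closure_Times dense)
    have "?F (u, w) = 0"
    proof (rule continuous_constant_on_closure[of ?S ?F])
      show "continuous_on (closure ?S) ?F"
        unfolding cl by (intro continuous_intros continuous_on_compose2[OF cont\<psi>]) auto
      fix p assume "p \<in> ?S"
      then obtain l l' where l: "l \<in> Lt" "l' \<in> Lt" "p = (snd l, snd l')"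
        by auto
      have "\<psi> (snd (l + l')) = character k (fst (l + l'))"
        by (rule ext[symmetric]) (rule is_lattice_add[OF lat l(1,2)])
      then show "?F p = 0"
        using ext[OF l(1)] ext[OF l(2)] l(3) by (simp add: character_add)
    qed (simp add: cl)
    then show ?thesis by simp
  qed
  ultimately show ?thesis
    using cont\<psi> ext unfolding internal_character_def by blast
qed

section \<open>Averages over the points of a window\<close>

lemma star_map_fst:
  assumes "cut_and_project_scheme Lt" "l \<in> Lt"
  shows "star_map Lt (fst l) = snd l"
  using assms unfolding star_map_def cut_and_project_scheme_def by (simp add: the_inv_into_f_f)

text \<open>Injectivity of \<open>fst\<close> on the lattice turns sums over points of physical
  space into lattice sums without repetition.\<close>

lemma sum_ball_part_cp_set:
  fixes Lt :: "((real^'m) \<times> (real^'n)) set"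
  assumes cps: "cut_and_project_scheme Lt" and W: "bounded W"
  shows "(\<Sum>x\<in>ball_part (cp_set Lt W) s. \<phi> (star_map Lt x) * \<xi> x)
    = (\<Sum>\<^sub>\<infinity>l\<in>Lt. truncation s (\<lambda>y. indicator W y *\<^sub>R \<phi> y) l * \<xi> (fst l))"
proof -
  have lat: "is_lattice Lt" and inj: "inj_on fst Lt"
    using cps unfolding cut_and_project_scheme_def by auto
  define F where "F = {l \<in> Lt. norm (fst l) \<le> s \<and> snd l \<in> W}"
  have "finite (Lt \<inter> (cball 0 s \<times> W))"
    by (intro is_lattice_finite_Int_bounded lat bounded_Times bounded_cball W)
  then have F: "finite F"
    by (rule rev_finite_subset) (auto simp: F_def)
  have img: "ball_part (cp_set Lt W) s = fst ` F"
    using star_map_fst[OF cps] unfolding ball_part_def cp_set_def F_def by force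
  have "inj_on fst F"
    using inj by (rule inj_on_subset) (auto simp: F_def)
  then have "(\<Sum>x\<in>ball_part (cp_set Lt W) s. \<phi> (star_map Lt x) * \<xi> x)
      = (\<Sum>l\<in>F. \<phi> (star_map Lt (fst l)) * \<xi> (fst l))"
    unfolding img by (simp add: sum.reindex)
  also have "\<dots> = (\<Sum>l\<in>F. truncation s (\<lambda>y. indicator W y *\<^sub>R \<phi> y) l * \<xi> (fst l))"
    by (rule sum.cong) (auto simp: F_def truncation_def star_map_fst[OF cps])
  also have "\<dots> = (\<Sum>\<^sub>\<infinity>l\<in>F. truncation s (\<lambda>y. indicator W y *\<^sub>R \<phi> y) l * \<xi> (fst l))"
    using F by simp
  also have "\<dots> = (\<Sum>\<^sub>\<infinity>l\<in>Lt. truncation s (\<lambda>y. indicator W y *\<^sub>R \<phi> y) l * \<xi> (fst l))"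
    by (rule infsum_cong_neutral) (auto simp: F_def truncation_def indicator_def)
  finally show ?thesis .
qed

text \<open>Averages divide by a number of points, equidistribution by a volume; normalizing
  numerator and denominator by the same volume reconciles them.\<close>

lemma tendsto_quotient_rescale:
  fixes X N :: "real \<Rightarrow> complex"
  assumes "((\<lambda>s. X s /\<^sub>R V s) \<longlongrightarrow> a) F" "((\<lambda>s. N s /\<^sub>R V s) \<longlongrightarrow> b) F" "b \<noteq> 0" "\<forall>\<^sub>F s in F. V s \<noteq> 0"
  shows "((\<lambda>s. 1 / N s * X s) \<longlongrightarrow> a / b) F"
proof (rule Lim_transform_eventually[OF tendsto_divide[OF assms(1-3)]])
  show "\<forall>\<^sub>F s in F. X s /\<^sub>R V s / (N s /\<^sub>R V s) = 1 / N s * X s"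
    using assms(4) by eventually_elim (simp add: scaleR_conv_of_real)
qed

definition window_mean :: "(real^'n) set \<Rightarrow> (real^'n \<Rightarrow> complex) \<Rightarrow> complex" where
  "window_mean W \<phi> = (LBINT y. indicator W y *\<^sub>R \<phi> y) / of_real (measure lborel W)"

lemma content_cball_eventually_nonzero:
  "\<forall>\<^sub>F s in at_top. measure lborel (cball (0::'a::euclidean_space) s) \<noteq> 0"
  using eventually_gt_at_top[of 0] by eventually_elim simp

lemma window_mean_1:
  assumes "compact W" "0 < measure lborel W"
  shows "window_mean W (\<lambda>_. 1) = 1"
  using assms borel_compact[OF assms(1)] emeasure_bounded_finite[OF compact_imp_bounded[OF assms(1)]]
  by (simp add: window_mean_def scaleR_conv_of_real less_top)

text \<open>The count of points is itself an equidistribution sum, with the constant function 1. The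
  volume of \<open>D\<close> occurs in numerator and denominator and cancels. The value
  \<open>a\<close> is left open to cover both the untwisted case and the vanishing twisted
  case.\<close>

lemma cp_set_average_tendsto:
  fixes Lt :: "((real^'m) \<times> (real^'n)) set" and W :: "(real^'n) set"
  assumes cps: "cut_and_project_scheme Lt"
    and W: "compact W" "frontier W \<in> null_sets lebesgue" "0 < measure lborel W"
    and lim: "\<And>D. D \<in> sets borel \<Longrightarrow> bounded D \<Longrightarrow> (\<And>z. \<exists>!l. l \<in> Lt \<and> z - l \<in> D) \<Longrightarrow>
      ((\<lambda>s. (\<Sum>\<^sub>\<infinity>l\<in>Lt. truncation s (\<lambda>y. indicator W y *\<^sub>R \<phi> y) l * \<xi> (fst l))
        /\<^sub>R measure lborel (cball (0::real^'m) s)) \<longlongrightarrow> a /\<^sub>R measure lborel D) at_top"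
  shows "((\<lambda>s. 1 / of_nat (card (ball_part (cp_set Lt W) s)) *
      (\<Sum>x\<in>ball_part (cp_set Lt W) s. \<phi> (star_map Lt x) * \<xi> x)) \<longlongrightarrow> a / of_real (measure lborel W)) at_top"
proof -
  have lat: "is_lattice Lt"
    using cps unfolding cut_and_project_scheme_def by blast
  obtain D where D: "D \<in> sets borel" "bounded D" "\<And>z. \<exists>!l. l \<in> Lt \<and> z - l \<in> D"
    using is_lattice_fundamental_domain[OF lat] by blast
  have v: "0 < measure lborel D"
    by (rule fundamental_domain_measure_pos[OF lat D])
  have W1: "(LBINT y. indicator W y *\<^sub>R (1::complex)) = of_real (measure lborel W)"
    using window_mean_1[OF W(1,3)] W(3) unfolding window_mean_def by simp
  have card: "of_nat (card (ball_part (cp_set Lt W) s)) = (\<Sum>\<^sub>\<infinity>l\<in>Lt. truncation s (\<lambda>y. indicator W y *\<^sub>R 1) l)" for s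
    using sum_ball_part_cp_set[OF cps compact_imp_bounded[OF W(1)], of "\<lambda>_. 1" "\<lambda>_. 1" s] by simp
  from tendsto_quotient_rescale[OF lim[OF D]
      truncation_equidistribution[OF cps D riemann_controlled_window[OF W(1,2) continuous_on_const[of _ 1]]]
      _ content_cball_eventually_nonzero]
  show ?thesis
    unfolding sum_ball_part_cp_set[OF cps compact_imp_bounded[OF W(1)]] card W1
    using v W(3) by (simp add: scaleR_conv_of_real)
qed

lemma cp_set_mean_tendsto:
  fixes Lt :: "((real^'m) \<times> (real^'n)) set"
  assumes cps: "cut_and_project_scheme Lt"
    and W: "compact W" "frontier W \<in> null_sets lebesgue" "0 < measure lborel W"
    and \<phi>: "continuous_on UNIV \<phi>"
  shows "((\<lambda>s. 1 / of_nat (card (ball_part (cp_set Lt W) s)) * (\<Sum>x\<in>ball_part (cp_set Lt W) s. \<phi> (star_map Lt x)))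
     \<longlongrightarrow> window_mean W \<phi>) at_top"
  using cp_set_average_tendsto[OF cps W, of \<phi> "\<lambda>_. 1" "LBINT y. indicator W y *\<^sub>R \<phi> y"]
    truncation_equidistribution[OF cps _ _ _ riemann_controlled_window[OF W(1,2) \<phi>]]
  unfolding window_mean_def by simp

lemma cp_set_twisted_mean_tendsto_0:
  fixes Lt :: "((real^'m) \<times> (real^'n)) set"
  assumes cps: "cut_and_project_scheme Lt"
    and W: "compact W" "frontier W \<in> null_sets lebesgue" "0 < measure lborel W"
    and \<phi>: "continuous_on UNIV \<phi>" and "\<nexists>\<psi>. internal_character Lt k \<psi>"
  shows "((\<lambda>s. 1 / of_nat (card (ball_part (cp_set Lt W) s)) *
      (\<Sum>x\<in>ball_part (cp_set Lt W) s. \<phi> (star_map Lt x) * character k x)) \<longlongrightarrow> 0) at_top"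
proof -
  obtain \<eta> where \<eta>: "0 < \<eta>" "\<And>\<epsilon>. 0 < \<epsilon> \<Longrightarrow> \<exists>l\<in>Lt. norm (snd l) < \<epsilon> \<and> \<eta> \<le> norm (character k (fst l) - 1)"
    using internal_character_exists[OF cps, of k] assms(6) by (meson not_less)
  have "((\<lambda>s. (\<Sum>\<^sub>\<infinity>l\<in>Lt. truncation s (\<lambda>y. indicator W y *\<^sub>R \<phi> y) l * character k (fst l))
      /\<^sub>R measure lborel (cball (0::real^'m) s)) \<longlongrightarrow> 0) at_top"
    by (rule truncation_twisted_tendsto_0[OF cps riemann_controlled_window[OF W(1,2) \<phi>] _ _ \<eta>])
      (auto simp: character_add)
  then show ?thesis
    using cp_set_average_tendsto[OF cps W, of \<phi> "character k" 0] by simp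
qed

text \<open>On the points of the set \<open>character k\<close> is \<open>\<psi>\<close> of the
  star, so the twisted mean is an ordinary mean with weight
  \<open>\<phi> y * \<psi> y\<close>.\<close>

lemma cp_set_twisted_mean_tendsto:
  fixes Lt :: "((real^'m) \<times> (real^'n)) set"
  assumes "cut_and_project_scheme Lt" "compact W" "frontier W \<in> null_sets lebesgue" "0 < measure lborel W"
    and "continuous_on UNIV \<phi>" "internal_character Lt k \<psi>"
  shows "((\<lambda>s. 1 / of_nat (card (ball_part (cp_set Lt W) s)) *
      (\<Sum>x\<in>ball_part (cp_set Lt W) s. \<phi> (star_map Lt x) * character k x))
     \<longlongrightarrow> window_mean W (\<lambda>y. \<phi> y * \<psi> y)) at_top"
proof -
  have ch: "character k x = \<psi> (star_map Lt x)" if "x \<in> ball_part (cp_set Lt W) s" for x s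
    using that assms(6) star_map_fst[OF assms(1)]
    unfolding ball_part_def cp_set_def internal_character_def by auto
  have "continuous_on UNIV (\<lambda>y. \<phi> y * \<psi> y)"
    using assms(5,6) unfolding internal_character_def by (intro continuous_intros) auto
  from cp_set_mean_tendsto[OF assms(1-4) this] show ?thesis
    by (simp add: ch cong: sum.cong)
qed

section \<open>The induced internal map\<close>

text \<open>The sum is the Horner form of a composition of maps
  \<open>y \<mapsto> A *v y + (u + b i)\<close> applied to 0, and each of them preserves
  \<open>\<Omega>\<close>. The map with index 0 acts last, hence the shifted sequence in the
  induction.\<close>

lemma window_translations_affine_sum:
  assumes b: "\<And>i::nat. u + b i \<in> window_translations A \<Omega>" and "0 \<in> \<Omega>"
  shows "(\<Sum>i<N. ((\<lambda>x. A *v x) ^^ i) (u + b i)) \<in> \<Omega>"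
  using b
proof (induction N arbitrary: b)
  case 0
  then show ?case using \<open>0 \<in> \<Omega>\<close> by simp
next
  case (Suc N)
  have "(\<Sum>i<N. ((\<lambda>x. A *v x) ^^ i) (u + b (Suc i))) \<in> \<Omega>"
    by (rule Suc.IH) (rule Suc.prems)
  then have "A *v (\<Sum>i<N. ((\<lambda>x. A *v x) ^^ i) (u + b (Suc i))) + (u + b 0) \<in> \<Omega>"
    using Suc.prems[of 0] unfolding window_translations_def by auto
  then show ?case
    by (simp add: sum.lessThan_Suc_shift linear_sum[OF matrix_vector_mul_linear] add.commute del: sum.lessThan_Suc)
qed

lemma linear_funpow: "linear f \<Longrightarrow> linear (f ^^ N)" for f :: "'a::real_vector \<Rightarrow> 'a"
  by (induction N) (auto intro: linear_compose simp: linear_id)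

text \<open>Every sum \<open>\<Sum>i<N. A\<^sup>i (u + b\<^sub>i)\<close> with \<open>u + b\<^sub>i\<close> in the interior of the set of translations lies in
  the bounded set \<open>\<Omega>\<close>. Choosing \<open>b\<^sub>i = \<plusminus>w\<close> with signs adapted to one coordinate shows that the
  coordinates of \<open>A\<^sup>i w\<close> are absolutely summable.\<close>

lemma window_contraction:
  fixes A :: "real^'n^'n"
  assumes "bounded \<Omega>" "0 \<in> \<Omega>" "interior (window_translations A \<Omega>) \<noteq> {}"
  shows "(\<lambda>N. ((\<lambda>x. A *v x) ^^ N) z) \<longlonglongrightarrow> 0"
proof -
  let ?P = "\<lambda>N. (\<lambda>x. A *v x) ^^ N"
  have lin: "linear (?P N)" for N
    by (rule linear_funpow) (rule matrix_vector_mul_linear)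
  obtain u where "u \<in> interior (window_translations A \<Omega>)"
    using assms(3) by blast
  then obtain \<rho> where \<rho>: "0 < \<rho>" "cball u \<rho> \<subseteq> window_translations A \<Omega>"
    unfolding mem_interior_cball by blast
  obtain M where M: "\<And>y. y \<in> \<Omega> \<Longrightarrow> norm y \<le> M"
    using assms(1) unfolding bounded_iff by blast
  have small: "(\<lambda>N. ?P N w) \<longlonglongrightarrow> 0" if w: "norm w \<le> \<rho>" for w
  proof (rule vec_tendstoI)
    fix j
    have "summable (\<lambda>i. norm (?P i w $ j))"
    proof (rule summableI_nonneg_bounded)
      fix N
      \<comment> \<open>The sign makes coordinate \<open>j\<close> of the \<open>i\<close>-th term
        equal to its absolute value; a zero sign only shortens the vector.\<close>
      define b where "b i = sgn (?P i w $ j) *\<^sub>R w" for i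
      have nb: "norm (b i) \<le> \<rho>" for i
        using w \<rho>(1) by (simp add: b_def sgn_real_def)
      have "u + b i \<in> window_translations A \<Omega>" "u + - b i \<in> window_translations A \<Omega>" for i
        using \<rho>(2) nb[of i] by (auto simp: dist_norm)
      then have "norm (\<Sum>i<N. ?P i (u + b i)) \<le> M" "norm (\<Sum>i<N. ?P i (u + - b i)) \<le> M"
        using window_translations_affine_sum[OF _ assms(2), of u b A N]
          window_translations_affine_sum[OF _ assms(2), of u "\<lambda>i. - b i" A N] M by auto
      \<comment> \<open>Subtracting the sums for both choices of sign eliminates the unknown centre
        \<open>u\<close>.\<close>
      then have "norm ((\<Sum>i<N. ?P i (u + b i)) - (\<Sum>i<N. ?P i (u + - b i))) \<le> 2 * M"
        using norm_triangle_ineq4[of "\<Sum>i<N. ?P i (u + b i)" "\<Sum>i<N. ?P i (u + - b i)"] by linarith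
      also have "(\<Sum>i<N. ?P i (u + b i)) - (\<Sum>i<N. ?P i (u + - b i)) = 2 *\<^sub>R (\<Sum>i<N. ?P i (b i))"
        by (simp add: linear_add[OF lin] linear_neg[OF lin] linear_diff[OF lin] sum_subtractf[symmetric]
            scaleR_sum_right scaleR_2)
      finally have "norm (\<Sum>i<N. ?P i (b i)) \<le> M"
        by simp
      then have "\<bar>(\<Sum>i<N. ?P i (b i)) $ j\<bar> \<le> M"
        using component_le_norm_cart[of "\<Sum>i<N. ?P i (b i)" j] by linarith
      also have "(\<Sum>i<N. ?P i (b i)) $ j = (\<Sum>i<N. norm (?P i w $ j))"
        by (simp add: b_def linear_scale[OF lin] abs_sgn mult.commute)
      finally show "(\<Sum>i<N. norm (?P i w $ j)) \<le> M"
        by linarith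
    qed simp
    then have "(\<lambda>i. norm (?P i w $ j)) \<longlonglongrightarrow> 0"
      by (rule summable_LIMSEQ_zero)
    then show "(\<lambda>i. ?P i w $ j) \<longlonglongrightarrow> 0 $ j"
      using tendsto_norm_zero_cancel[of "\<lambda>i. ?P i w $ j"] by simp
  qed
  \<comment> \<open>Scales \<open>z\<close> into the ball of radius \<open>\<rho>\<close>; the 1
    covers \<open>z = 0\<close>.\<close>
  define c where "c = \<rho> / (norm z + 1)"
  have c: "0 < c" "norm (c *\<^sub>R z) \<le> \<rho>"
  proof -
    have "0 < norm z + 1" using norm_ge_zero[of z] by linarith
    then show "0 < c" "norm (c *\<^sub>R z) \<le> \<rho>"
      unfolding c_def using \<rho>(1) by (simp_all add: field_simps)
  qed
  have "(\<lambda>N. (1 / c) *\<^sub>R ?P N (c *\<^sub>R z)) \<longlonglongrightarrow> (1 / c) *\<^sub>R 0"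
    by (intro tendsto_intros small c)
  then show ?thesis
    using c(1) by (simp add: linear_scale[OF lin])
qed

section \<open>Linear images of Lebesgue measure\<close>

lemma nn_integral_lborel_shift:
  fixes f :: "'a::euclidean_space \<Rightarrow> ennreal"
  assumes [measurable]: "f \<in> borel_measurable borel"
  shows "(\<integral>\<^sup>+y. f (y - t) \<partial>lborel) = (\<integral>\<^sup>+y. f y \<partial>lborel)"
    and "(\<integral>\<^sup>+y. f (t - y) \<partial>lborel) = (\<integral>\<^sup>+y. f y \<partial>lborel)"
proof -
  have shift: "(\<integral>\<^sup>+y. g (s + y) \<partial>lborel) = (\<integral>\<^sup>+y. g y \<partial>lborel)"
    if [measurable]: "g \<in> borel_measurable borel" for g :: "'a \<Rightarrow> ennreal" and s
    using nn_integral_distr[of "(+) s" lborel borel g] by (simp add: lborel_distr_plus)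
  show "(\<integral>\<^sup>+y. f (y - t) \<partial>lborel) = (\<integral>\<^sup>+y. f y \<partial>lborel)"
    using shift[of f "- t"] by simp
  have reflect: "distr lborel borel uminus = (lborel :: 'a measure)"
    using lborel_affine[of "- 1" "0::'a"] by (simp add: density_1 one_ennreal_def[symmetric])
  have "(\<integral>\<^sup>+y. f (t - y) \<partial>lborel) = (\<integral>\<^sup>+y. f (t + y) \<partial>lborel)"
    using nn_integral_distr[of uminus lborel borel "\<lambda>y. f (t + y)"] by (simp add: reflect)
  then show "(\<integral>\<^sup>+y. f (t - y) \<partial>lborel) = (\<integral>\<^sup>+y. f y \<partial>lborel)"
    using shift[of f t] by simp
qed

text \<open>The library's change of variables for linear maps needs a well-ordered index type, so the image
  of Lebesgue measure is identified up to a constant by the uniqueness argument for Haar measure.\<close>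

lemma nn_integral_matrix_exchange:
  fixes A B :: "real^'n^'n" and f g :: "real^'n \<Rightarrow> ennreal"
  assumes AB: "A ** B = mat 1"
    and [measurable]: "f \<in> borel_measurable borel" "g \<in> borel_measurable borel"
  shows "(\<integral>\<^sup>+z. f (A *v z) \<partial>lborel) * (\<integral>\<^sup>+y. g y \<partial>lborel)
    = (\<integral>\<^sup>+z. g (A *v z) \<partial>lborel) * (\<integral>\<^sup>+y. f y \<partial>lborel)"
proof -
  have contA: "continuous_on UNIV ((*v) A)"
    by (rule linear_continuous_on) (simp add: matrix_vector_mul_bounded_linear)
  have [measurable]: "(*v) A \<in> borel_measurable borel"
    by (rule borel_measurable_continuous_onI[OF contA])
  have swap: "(\<integral>\<^sup>+z. \<integral>\<^sup>+y. F (A *v z) (y - A *v z) \<partial>lborel \<partial>lborel)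
      = (\<integral>\<^sup>+y. \<integral>\<^sup>+z. F (A *v z) (y - A *v z) \<partial>lborel \<partial>lborel)"
    if [measurable]: "case_prod F \<in> borel_measurable (borel \<Otimes>\<^sub>M borel)" for F :: "real^'n \<Rightarrow> real^'n \<Rightarrow> ennreal"
    by (rule lborel_pair.Fubini') measurable
  have "(\<integral>\<^sup>+z. f (A *v z) \<partial>lborel) * (\<integral>\<^sup>+y. g y \<partial>lborel)
      = (\<integral>\<^sup>+z. \<integral>\<^sup>+y. f (A *v z) * g (y - A *v z) \<partial>lborel \<partial>lborel)"
    by (simp add: nn_integral_cmult nn_integral_multc nn_integral_lborel_shift(1)[of g])
  also have "\<dots> = (\<integral>\<^sup>+y. \<integral>\<^sup>+z. f (A *v z) * g (y - A *v z) \<partial>lborel \<partial>lborel)"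
    by (rule swap) measurable
  also have "\<dots> = (\<integral>\<^sup>+y. \<integral>\<^sup>+z. g (A *v z) * f (y - A *v z) \<partial>lborel \<partial>lborel)"
  proof (rule nn_integral_cong)
    fix y :: "real^'n"
    \<comment> \<open>The reflection \<open>z \<mapsto> B *v y - z\<close> interchanges the
      arguments \<open>A *v z\<close> and \<open>y - A *v z\<close>, and with them the roles of
      \<open>f\<close> and \<open>g\<close>.\<close>
    have "A *v (B *v y - z) = y - A *v z" for z
      using AB by (simp add: matrix_vector_mult_diff_distrib matrix_vector_mul_assoc)
    then show "(\<integral>\<^sup>+z. f (A *v z) * g (y - A *v z) \<partial>lborel) = (\<integral>\<^sup>+z. g (A *v z) * f (y - A *v z) \<partial>lborel)"
      using nn_integral_lborel_shift(2)[of "\<lambda>z. f (A *v z) * g (y - A *v z)" "B *v y"] by (simp add: mult.commute)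
  qed
  also have "\<dots> = (\<integral>\<^sup>+z. \<integral>\<^sup>+y. g (A *v z) * f (y - A *v z) \<partial>lborel \<partial>lborel)"
    by (rule swap[symmetric]) measurable
  also have "\<dots> = (\<integral>\<^sup>+z. g (A *v z) \<partial>lborel) * (\<integral>\<^sup>+y. f y \<partial>lborel)"
    by (simp add: nn_integral_cmult nn_integral_multc nn_integral_lborel_shift(1)[of f])
  finally show ?thesis .
qed

text \<open>The exchange identity for a Borel set and the unit ball makes the two measures
  proportional. The factor is legitimate because the image measure of the ball is finite, its
  preimage being bounded, and nonzero.\<close>

lemma lborel_matrix_image:
  fixes A B :: "real^'n^'n"
  assumes AB: "A ** B = mat 1" "B ** A = mat 1"
  obtains c :: real where "0 \<le> c" "lborel = density (distr lborel borel ((*v) A)) (\<lambda>_. ennreal c)"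
proof -
  have contA: "continuous_on UNIV ((*v) A)"
    by (rule linear_continuous_on) (simp add: matrix_vector_mul_bounded_linear)
  have [measurable]: "(*v) A \<in> borel_measurable borel"
    by (rule borel_measurable_continuous_onI[OF contA])
  let ?\<mu> = "distr lborel borel ((*v) A)"
  let ?C = "cball (0::real^'n) 1"
  have \<mu>: "emeasure ?\<mu> E = (\<integral>\<^sup>+z. indicator E (A *v z) \<partial>lborel)" if "E \<in> sets borel" for E
    using that nn_integral_distr[of "(*v) A" lborel borel "indicator E"]
    by (simp add: nn_integral_indicator)
  have exch: "emeasure ?\<mu> E * emeasure lborel ?C = emeasure ?\<mu> ?C * emeasure lborel E" if "E \<in> sets borel" for E
    using nn_integral_matrix_exchange[OF AB(1), of "indicator E" "indicator ?C"] that
      borel_measurable_indicator[of ?C borel]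
    by (simp add: \<mu> borel_closed)
  have "(*v) A -` ?C \<subseteq> (*v) B ` ?C"
  proof
    fix x assume "x \<in> (*v) A -` ?C"
    then show "x \<in> (*v) B ` ?C"
      using AB(2) by (intro image_eqI[of _ _ "A *v x"]) (auto simp: matrix_vector_mul_assoc)
  qed
  then have "bounded ((*v) A -` ?C)"
    by (rule bounded_subset[rotated]) (intro bounded_linear_image bounded_cball matrix_vector_mul_bounded_linear)
  then have fin: "emeasure ?\<mu> ?C < \<infinity>"
    using emeasure_bounded_finite[of "(*v) A -` ?C"] by (simp add: emeasure_distr less_top)
  obtain b where b: "emeasure ?\<mu> ?C = ennreal b" "0 \<le> b"
    using fin by (cases "emeasure ?\<mu> ?C") auto
  obtain a where a: "emeasure lborel ?C = ennreal a" "0 < a"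
  proof -
    have "emeasure lborel ?C = ennreal (measure lborel ?C)"
      using emeasure_bounded_finite[OF bounded_cball, of "0::real^'n" 1] by (simp add: emeasure_eq_ennreal_measure less_top)
    then show ?thesis
      using that[of "measure lborel ?C"] by simp
  qed
  \<comment> \<open>Otherwise the exchange identity with \<open>UNIV\<close> would give the image
    measure total mass 0.\<close>
  have "b \<noteq> 0"
  proof
    assume "b = 0"
    then have "emeasure ?\<mu> UNIV * ennreal a = 0"
      using exch[of UNIV] a b by simp
    then have "emeasure ?\<mu> UNIV = 0"
      using a(2) by simp
    then show False
      by (simp add: emeasure_distr)
  qed
  have "lborel = density ?\<mu> (\<lambda>_. ennreal (a / b))"
  proof (rule measure_eqI)
    fix E :: "(real^'n) set" assume "E \<in> sets lborel"
    then have E: "E \<in> sets borel" by simp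
    have "emeasure (density ?\<mu> (\<lambda>_. ennreal (a / b))) E = ennreal (a / b) * emeasure ?\<mu> E"
      using E by (simp add: emeasure_density_const)
    also have "\<dots> = ennreal (1 / b) * (emeasure ?\<mu> E * ennreal a)"
    proof -
      have "ennreal (a / b) = ennreal (1 / b) * ennreal a"
        using a(2) b(2) by (simp add: ennreal_mult[symmetric])
      then show ?thesis
        by (simp add: mult_ac)
    qed
    also have "\<dots> = ennreal (1 / b) * ennreal b * emeasure lborel E"
      using exch[OF E] a b by (simp add: mult.assoc)
    also have "\<dots> = emeasure lborel E"
      using b(2) \<open>b \<noteq> 0\<close> by (simp add: ennreal_mult[symmetric])
    finally show "emeasure lborel E = emeasure (density ?\<mu> (\<lambda>_. ennreal (a / b))) E" ..
  qed simp
  then show thesis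
    using that[of "a / b"] a(2) b(2) by simp
qed

text \<open>\<open>c\<close> is the Jacobian of \<open>A\<close>, left unevaluated. What matters is
  that one constant serves all \<open>F\<close> and all translations \<open>u\<close>.\<close>

lemma lborel_integral_affine:
  fixes A B :: "real^'n^'n"
  assumes AB: "A ** B = mat 1" "B ** A = mat 1"
  obtains c :: real where "\<And>(F :: real^'n \<Rightarrow> complex) u. F \<in> borel_measurable borel \<Longrightarrow>
    integral\<^sup>L lborel F = c *\<^sub>R (LBINT z. F (A *v z + u))"
proof -
  obtain c where c: "0 \<le> c" "lborel = density (distr lborel borel ((*v) A)) (\<lambda>_. ennreal c)"
    using lborel_matrix_image[OF AB] by blast
  have contA: "continuous_on UNIV ((*v) A)"
    by (rule linear_continuous_on) (simp add: matrix_vector_mul_bounded_linear)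
  have [measurable]: "(*v) A \<in> borel_measurable borel"
    by (rule borel_measurable_continuous_onI[OF contA])
  have "integral\<^sup>L lborel F = c *\<^sub>R (LBINT z. F (A *v z + u))"
    if [measurable]: "F \<in> borel_measurable borel" for F :: "real^'n \<Rightarrow> complex" and u
  proof -
    have "integral\<^sup>L lborel F = integral\<^sup>L (distr lborel borel ((+) u)) F"
      by (simp add: lborel_distr_plus)
    also have "\<dots> = (LBINT y. F (u + y))"
      by (rule integral_distr) auto
    also have "\<dots> = integral\<^sup>L (density (distr lborel borel ((*v) A)) (\<lambda>_. ennreal c)) (\<lambda>y. F (u + y))"
      using c(2) by simp
    also have "\<dots> = integral\<^sup>L (distr lborel borel ((*v) A)) (\<lambda>y. c *\<^sub>R F (u + y))"
      by (rule integral_density) (use c(1) in auto)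
    also have "\<dots> = (LBINT z. c *\<^sub>R F (u + A *v z))"
      by (rule integral_distr) auto
    finally show ?thesis
      by (simp add: add.commute)
  qed
  then show thesis
    using that by blast
qed

lemma measure_lborel_pos_interior:
  fixes W :: "'a::euclidean_space set"
  assumes "compact W" "interior W \<noteq> {}"
  shows "0 < measure lborel W"
proof -
  obtain x e where e: "0 < e" "cball x e \<subseteq> W"
    using assms(2) mem_interior_cball by blast
  have "0 < measure lborel (cball x e)"
    using e(1) by simp
  also have "\<dots> \<le> measure lborel W"
    using assms(1) e(2) emeasure_bounded_finite[OF compact_imp_bounded[OF assms(1)]]
    by (intro measure_mono_fmeasurable) (auto simp: fmeasurable_def borel_compact)
  finally show ?thesis .
qed

text \<open>An intersection of closed preimages of \<open>\<Omega>\<close>; the condition at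
  \<open>y = 0\<close> places it inside \<open>\<Omega>\<close>.\<close>

lemma compact_window_translations:
  fixes A :: "real^'n^'n"
  assumes "compact \<Omega>" "0 \<in> \<Omega>"
  shows "compact (window_translations A \<Omega>)"
proof -
  have eq: "window_translations A \<Omega> = (\<Inter>y\<in>\<Omega>. (\<lambda>u. A *v y + u) -` \<Omega>)"
    unfolding window_translations_def by auto
  have "closed (window_translations A \<Omega>)"
    unfolding eq using assms(1)
    by (intro closed_INT ballI closed_vimage compact_imp_closed continuous_intros)
  moreover have "window_translations A \<Omega> \<subseteq> \<Omega>"
    using assms(2) unfolding window_translations_def by force
  ultimately show ?thesis
    using assms(1) by (metis compact_Int_closed inf.absorb_iff2)
qed

section \<open>The refinement equation\<close>

lemma continuous_on_matrix_vector [continuous_intros]: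
  fixes A :: "real^'n^'m"
  assumes "continuous_on S g"
  shows "continuous_on S (\<lambda>x. A *v g x)"
  by (rule bounded_linear.continuous_on[OF matrix_vector_mul_bounded_linear assms])

lemma continuous_compact_support_bounded:
  fixes f :: "'a::topological_space \<Rightarrow> 'b::real_normed_vector"
  assumes "continuous_on UNIV f" "compact \<Omega>" "\<And>y. f y \<noteq> 0 \<Longrightarrow> y \<in> \<Omega>"
  obtains M where "0 \<le> M" "\<And>y. norm (f y) \<le> M"
proof -
  have "bounded (f ` \<Omega>)"
    using assms(1,2) by (intro compact_imp_bounded compact_continuous_image) (auto intro: continuous_on_subset)
  then obtain M where M: "0 < M" "\<And>y. y \<in> \<Omega> \<Longrightarrow> norm (f y) \<le> M"
    unfolding bounded_pos by auto
  have "norm (f y) \<le> M" for y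
    using M assms(3) by (cases "f y = 0") auto
  then show thesis
    using that[of M] M(1) by simp
qed

text \<open>Dominated convergence on the bounded set \<open>U\<close>. Continuity is what carries
  the refinement equation from a dense set to all of internal space.\<close>

lemma window_mean_convolution_continuous:
  fixes f :: "real^'n \<Rightarrow> complex" and B :: "real^'n^'n"
  assumes f: "continuous_on UNIV f" and M: "\<And>y. norm (f y) \<le> M" and U: "compact U"
  shows "continuous_on UNIV (\<lambda>y. window_mean U (\<lambda>u. f (B *v (y - u))))"
proof -
  have [measurable]: "U \<in> sets borel"
    using U by (simp add: borel_compact)
  have meas: "(\<lambda>u. f (B *v (y - u))) \<in> borel_measurable borel" for y
    by (intro borel_measurable_continuous_onI continuous_on_compose2[OF f] continuous_intros) auto
  have "continuous_on UNIV (\<lambda>y. LBINT u. indicator U u *\<^sub>R f (B *v (y - u)))"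
    unfolding continuous_on_sequentially
  proof (intro allI ballI impI)
    fix X :: "nat \<Rightarrow> real^'n" and y
    assume X: "(\<forall>n. X n \<in> UNIV) \<and> X \<longlonglongrightarrow> y"
    show "((\<lambda>y. LBINT u. indicator U u *\<^sub>R f (B *v (y - u))) \<circ> X) \<longlonglongrightarrow> (LBINT u. indicator U u *\<^sub>R f (B *v (y - u)))"
      unfolding o_def
    proof (rule integral_dominated_convergence[where w="\<lambda>u. M * indicator U u"])
      show "integrable lborel (\<lambda>u. M * indicator U u)"
        by (intro integrable_mult_right integrable_indicator_bounded compact_imp_bounded U) simp
      show "AE u in lborel. (\<lambda>n. indicator U u *\<^sub>R f (B *v (X n - u))) \<longlonglongrightarrow> indicator U u *\<^sub>R f (B *v (y - u))"
      proof (rule AE_I2)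
        fix u
        have "continuous_on UNIV (\<lambda>y. f (B *v (y - u)))"
          by (intro continuous_on_compose2[OF f] continuous_intros) auto
        then have "(\<lambda>n. f (B *v (X n - u))) \<longlonglongrightarrow> f (B *v (y - u))"
          using X by (auto simp: continuous_on_sequentially o_def)
        then show "(\<lambda>n. indicator U u *\<^sub>R f (B *v (X n - u))) \<longlonglongrightarrow> indicator U u *\<^sub>R f (B *v (y - u))"
          by (intro tendsto_intros)
      qed
      show "AE u in lborel. norm (indicator U u *\<^sub>R f (B *v (X n - u))) \<le> M * indicator U u" for n
        using M by (intro AE_I2) (simp add: indicator_def)
    qed (use meas in auto)
  qed
  then show ?thesis
    unfolding window_mean_def divide_inverse by (intro continuous_on_mult continuous_on_const)
qed

text \<open>Fubini and the substitution \<open>y = A *v z + u\<close> split \<open>\<psi> y\<close>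
  into \<open>\<psi> u * \<psi> (A *v z)\<close>. The constant \<open>C\<close> is
  \<open>\<kappa>\<close> times the Jacobian and is obtained before \<open>\<psi>\<close>, so it may
  be evaluated at any single character.\<close>

lemma refinement_equation_transform:
  fixes f :: "real^'n \<Rightarrow> complex" and A B :: "real^'n^'n"
  assumes AB: "A ** B = mat 1" "B ** A = mat 1"
    and f: "continuous_on UNIV f" "\<And>y. f y \<noteq> 0 \<Longrightarrow> y \<in> \<Omega>" and \<Omega>: "compact \<Omega>"
    and U: "compact U" "\<And>u y. u \<in> U \<Longrightarrow> y \<in> \<Omega> \<Longrightarrow> A *v y + u \<in> \<Omega>"
    and eq: "\<And>y. f y = \<kappa> * window_mean U (\<lambda>u. f (B *v (y - u)))"
  obtains C where "\<And>\<psi>. continuous_on UNIV \<psi> \<Longrightarrow> (\<And>y. norm (\<psi> y) = 1) \<Longrightarrow> (\<And>u w. \<psi> (u + w) = \<psi> u * \<psi> w) \<Longrightarrow>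
    (LBINT y. f y * \<psi> y) = C * window_mean U \<psi> * (LBINT y. f y * \<psi> (A *v y))"
proof -
  obtain M where M: "0 \<le> M" "\<And>y. norm (f y) \<le> M"
    using continuous_compact_support_bounded[OF f(1) \<Omega> f(2)] by blast
  have [measurable]: "U \<in> sets borel" "\<Omega> \<in> sets borel"
    using U \<Omega> by (auto simp: borel_compact)
  obtain c where c: "\<And>(F :: real^'n \<Rightarrow> complex) u. F \<in> borel_measurable borel \<Longrightarrow>
      integral\<^sup>L lborel F = c *\<^sub>R (LBINT z. F (A *v z + u))"
    using lborel_integral_affine[OF AB] by blast
  have "(LBINT y. f y * \<psi> y) = (\<kappa> * of_real c) * window_mean U \<psi> * (LBINT y. f y * \<psi> (A *v y))"
    if \<psi>: "continuous_on UNIV \<psi>" "\<And>y. norm (\<psi> y) = 1" "\<And>u w. \<psi> (u + w) = \<psi> u * \<psi> w" for \<psi>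
  proof -
    define F where "F y u = indicator U u *\<^sub>R (\<psi> y * f (B *v (y - u)))" for y u
    have contF: "continuous_on UNIV (\<lambda>p. \<psi> (fst p) * f (B *v (fst p - snd p)))"
      by (intro continuous_on_mult continuous_on_compose2[OF f(1)] continuous_on_compose2[OF \<psi>(1)] continuous_intros) auto
    have "(\<lambda>p. indicator U (snd p) *\<^sub>R (\<psi> (fst p) * f (B *v (fst p - snd p)))) \<in> borel_measurable borel"
    proof (rule borel_measurable_scaleR[OF _ borel_measurable_continuous_onI[OF contF]])
      have "(\<lambda>p :: (real^'n) \<times> (real^'n). indicator U (snd p) :: real) \<in> borel_measurable (borel \<Otimes>\<^sub>M borel)"
        by measurable
      then show "(\<lambda>p :: (real^'n) \<times> (real^'n). indicator U (snd p) :: real) \<in> borel_measurable borel"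
        by (simp add: borel_prod)
    qed
    then have measF: "case_prod F \<in> borel_measurable (lborel \<Otimes>\<^sub>M lborel)"
      by (simp add: F_def case_prod_unfold lborel_prod)
    have iU: "integrable lborel (indicator U :: real^'n \<Rightarrow> real)"
      and i\<Omega>: "integrable lborel (indicator \<Omega> :: real^'n \<Rightarrow> real)"
      by (auto intro!: integrable_indicator_bounded compact_imp_bounded U \<Omega>)
    have intF: "integrable (lborel \<Otimes>\<^sub>M lborel) (case_prod F)"
    proof (rule Bochner_Integration.integrable_bound[OF _ measF])
      have "integrable lborel (\<lambda>p :: (real^'n) \<times> (real^'n). indicator \<Omega> (fst p) *\<^sub>R (M * indicator U (snd p)))"
        by (intro lborel_product_scaleR(1) i\<Omega> integrable_mult_right iU)
      then show "integrable (lborel \<Otimes>\<^sub>M lborel) (\<lambda>p :: (real^'n) \<times> (real^'n). indicator \<Omega> (fst p) *\<^sub>R (M * indicator U (snd p)))"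
        by (simp only: lborel_prod)
      show "AE p in lborel \<Otimes>\<^sub>M lborel. norm (case_prod F p) \<le> norm (indicator \<Omega> (fst p) *\<^sub>R (M * indicator U (snd p)))"
      proof (rule AE_I2)
        fix p :: "(real^'n) \<times> (real^'n)"
        obtain y u where p: "p = (y, u)" by fastforce
        show "norm (case_prod F p) \<le> norm (indicator \<Omega> (fst p) *\<^sub>R (M * indicator U (snd p)))"
        \<comment> \<open>A nonzero integrand means that \<open>B *v (y - u)\<close> lies in
          \<open>\<Omega>\<close>, and translations in \<open>U\<close> then bring \<open>y\<close>
          into \<open>\<Omega>\<close>. This gives the integrable majorant.\<close>
        proof (cases "u \<in> U \<and> f (B *v (y - u)) \<noteq> 0")
          case True
          have "A *v (B *v (y - u)) + u = y"
            using AB(1) by (simp add: matrix_vector_mul_assoc)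
          then have "y \<in> \<Omega>"
            using U(2)[of u "B *v (y - u)"] True f(2) by simp
          then show ?thesis
            using True M by (simp add: p F_def norm_mult \<psi>(2))
        qed (auto simp: p F_def)
      qed
    qed
    have inner: "(LBINT y. F y u) = of_real c * (indicator U u *\<^sub>R \<psi> u) * (LBINT y. f y * \<psi> (A *v y))" for u
    proof -
      have meas: "(\<lambda>y. \<psi> y * f (B *v (y - u))) \<in> borel_measurable borel"
        by (intro borel_measurable_continuous_onI continuous_on_mult \<psi>(1) continuous_on_compose2[OF f(1)] continuous_intros) auto
      have "(LBINT y. F y u) = indicator U u *\<^sub>R (LBINT y. \<psi> y * f (B *v (y - u)))"
        unfolding F_def by simp
      also have "(LBINT y. \<psi> y * f (B *v (y - u))) = c *\<^sub>R (LBINT z. \<psi> (A *v z + u) * f (B *v (A *v z + u - u)))"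
        by (rule c[OF meas])
      also have "(\<lambda>z. \<psi> (A *v z + u) * f (B *v (A *v z + u - u))) = (\<lambda>z. \<psi> u * (f z * \<psi> (A *v z)))"
        using AB(2) by (simp add: \<psi>(3) matrix_vector_mul_assoc mult_ac)
      finally show ?thesis
        by (simp add: scaleR_conv_of_real mult_ac)
    qed
    have "(LBINT y. f y * \<psi> y) = (LBINT y. (\<kappa> / of_real (measure lborel U)) * (LBINT u. F y u))"
    proof (rule Bochner_Integration.integral_cong[OF refl])
      fix y
      have "(LBINT u. F y u) = \<psi> y * (LBINT u. indicator U u *\<^sub>R f (B *v (y - u)))"
        unfolding F_def by (simp flip: integral_mult_right_zero)
      then show "f y * \<psi> y = (\<kappa> / of_real (measure lborel U)) * (LBINT u. F y u)"
        by (subst eq) (simp add: window_mean_def)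
    qed
    also have "\<dots> = (\<kappa> / of_real (measure lborel U)) * (LBINT y. LBINT u. F y u)"
      by simp
    also have "(LBINT y. LBINT u. F y u) = (LBINT u. LBINT y. F y u)"
      by (rule lborel_pair.Fubini_integral[OF intF, symmetric])
    also have "\<dots> = of_real c * (LBINT u. indicator U u *\<^sub>R \<psi> u) * (LBINT y. f y * \<psi> (A *v y))"
      unfolding inner by (simp only: integral_mult_left_zero integral_mult_right_zero)
    finally show ?thesis
      by (simp add: window_mean_def)
  qed
  then show thesis
    using that by blast
qed

section \<open>Iterates of the similarity and the induced map\<close>

lemma character_transpose: "character (transpose Q *v k) x = character k (Q *v x)"
  unfolding character_def by (simp add: transpose_matrix_vector dot_lmul_matrix)

lemma internal_character_transpose:
  assumes cps: "cut_and_project_scheme Lt" and QL: "(\<lambda>x. Q *v x) ` (fst ` Lt) = fst ` Lt"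
    and A: "induced_internal_map Lt Q A" and \<psi>: "internal_character Lt k \<psi>"
  shows "internal_character Lt (transpose Q *v k) (\<lambda>y. \<psi> (A *v y))"
  unfolding internal_character_def
proof (intro conjI allI ballI)
  show "continuous_on UNIV (\<lambda>y. \<psi> (A *v y))"
    using \<psi> unfolding internal_character_def
    by (auto intro: continuous_on_compose2[OF _ continuous_on_matrix_vector[OF continuous_on_id]])
  fix l assume l: "l \<in> Lt"
  then obtain l' where l': "l' \<in> Lt" "Q *v fst l = fst l'"
    using QL by blast
  have "snd l' = star_map Lt (Q *v fst l)"
    using star_map_fst[OF cps l'(1)] l'(2) by simp
  also have "\<dots> = A *v snd l"
    using A l star_map_fst[OF cps l] unfolding induced_internal_map_def by simp
  finally show "character (transpose Q *v k) (fst l) = \<psi> (A *v snd l)"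
    using \<psi> l' unfolding internal_character_def character_transpose by metis
qed (use \<psi> in \<open>auto simp: internal_character_def matrix_vector_right_distrib\<close>)

lemma internal_character_funpow:
  assumes "cut_and_project_scheme Lt" "(\<lambda>x. Q *v x) ` (fst ` Lt) = fst ` Lt"
    "induced_internal_map Lt Q A" "internal_character Lt k \<psi>"
  shows "internal_character Lt (((\<lambda>x. transpose Q *v x) ^^ N) k) (\<lambda>y. \<psi> (((\<lambda>x. A *v x) ^^ N) y))"
proof (induction N)
  case 0
  then show ?case using assms(4) by simp
next
  case (Suc N)
  \<comment> \<open>On frequencies the new factor acts outermost, on internal points innermost; the
    powers of \<open>A\<close> commute with \<open>A\<close>.\<close>
  have "((\<lambda>x. A *v x) ^^ Suc N) y = ((\<lambda>x. A *v x) ^^ N) (A *v y)" for y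
    by (simp only: funpow_Suc_right o_apply)
  then show ?case
    using internal_character_transpose[OF assms(1-3) Suc] by (simp only: funpow.simps o_apply)
qed

text \<open>The range is a subspace, hence closed, so density already gives surjectivity. The
  closure is there for \<open>A\<close>, whose image is only known to contain a dense set.\<close>

lemma surjective_matrix_inverse:
  fixes A :: "real^'n^'n"
  assumes "closure (span ((\<lambda>x. A *v x) ` S)) = UNIV"
  obtains B where "A ** B = mat 1" "B ** A = mat 1"
proof -
  have "subspace (range ((*v) A))"
    by (intro linear_subspace_image matrix_vector_mul_linear) simp
  moreover have "span ((\<lambda>x. A *v x) ` S) \<subseteq> range ((*v) A)"
    using \<open>subspace (range ((*v) A))\<close> by (intro span_minimal) auto
  ultimately have "surj ((*v) A)"
    using assms by (metis closed_subspace closure_minimal top.extremum_uniqueI)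
  then obtain B where "A ** B = mat 1"
    using matrix_right_invertible_surjective[of A] by blast
  then show thesis
    using that matrix_left_right_inverse by blast
qed

lemma fst_lattice_span:
  fixes Lt :: "((real^'m) \<times> (real^'n)) set"
  assumes "cut_and_project_scheme Lt"
  shows "span (fst ` Lt) = UNIV"
proof -
  have "span Lt = UNIV"
    using assms is_lattice_span unfolding cut_and_project_scheme_def by blast
  then have "span (fst ` Lt) = range (fst :: (real^'m) \<times> (real^'n) \<Rightarrow> real^'m)"
    using linear_span_image[OF linear_fst, of Lt] by simp
  then show ?thesis by simp
qed

lemma inv_affine_sim:
  assumes "Q ** Q' = mat 1" "Q' ** Q = mat 1"
  shows "inv (affine_sim Q v) x = Q' *v (x - v)"
proof -
  have "inv (affine_sim Q v) = (\<lambda>x. Q' *v (x - v))"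
    by (rule inv_equality) (use assms in \<open>simp_all add: affine_sim_def matrix_vector_mul_assoc\<close>)
  then show ?thesis by simp
qed

text \<open>The translations form a cut and project set with window
  \<open>window_translations A \<Omega>\<close>. At \<open>y = snd l\<close> the averages in the
  invariance condition therefore converge to a window mean as well, and uniqueness of limits gives
  the equation on a dense set.\<close>

lemma density_refinement_equation:
  fixes Lt :: "((real^'m) \<times> (real^'n)) set" and p :: "real^'m \<Rightarrow> real"
  assumes cps: "cut_and_project_scheme Lt" and \<Omega>: "compact \<Omega>" "0 \<in> \<Omega>" "0 < measure lborel \<Omega>"
    and QL: "(\<lambda>x. Q *v x) ` (fst ` Lt) = fst ` Lt" and A: "induced_internal_map Lt Q A"
    and Q': "Q ** Q' = mat 1" "Q' ** Q = mat 1" and B: "A ** B = mat 1" "B ** A = mat 1"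
    and U: "interior (window_translations A \<Omega>) \<noteq> {}" "frontier (window_translations A \<Omega>) \<in> null_sets lebesgue"
    and inv: "invariant_density Lt \<Omega> Q A p"
    and f: "continuous_on UNIV f" "\<And>y. f y \<noteq> 0 \<Longrightarrow> y \<in> \<Omega>"
    and p: "\<And>l. l \<in> Lt \<Longrightarrow> complex_of_real (p (fst l)) = of_real (measure lborel \<Omega>) * f (snd l)"
  shows "f y = of_real \<bar>det Q\<bar> * window_mean (window_translations A \<Omega>) (\<lambda>u. f (B *v (y - u)))"
proof -
  let ?U = "window_translations A \<Omega>"
  let ?w = "complex_of_real (measure lborel \<Omega>)"
  have lat: "is_lattice Lt" and dense: "closure (snd ` Lt) = UNIV"
    using cps unfolding cut_and_project_scheme_def by auto
  have Uc: "compact ?U"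
    by (rule compact_window_translations[OF \<Omega>(1,2)])
  obtain M where M: "\<And>y. norm (f y) \<le> M"
    using continuous_compact_support_bounded[OF f(1) \<Omega>(1) f(2)] by blast
  have T: "sim_translations Lt A \<Omega> = cp_set Lt ?U"
    unfolding sim_translations_def cp_set_def ..
  let ?F = "\<lambda>y. f y - of_real \<bar>det Q\<bar> * window_mean ?U (\<lambda>u. f (B *v (y - u)))"
  have "?F y = 0"
  proof (rule continuous_constant_on_closure[of "snd ` Lt" ?F])
    show "continuous_on (closure (snd ` Lt)) ?F"
      unfolding dense
      by (intro continuous_on_diff continuous_on_mult continuous_on_const f(1)
          window_mean_convolution_continuous[OF f(1) M Uc])
    fix y assume "y \<in> snd ` Lt"
    then obtain l where l: "l \<in> Lt" "y = snd l" by blast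
    define \<phi> where "\<phi> u = ?w * f (B *v (y - u))" for u
    have cont\<phi>: "continuous_on UNIV \<phi>"
      unfolding \<phi>_def by (intro continuous_on_mult continuous_on_const continuous_on_compose2[OF f(1)] continuous_intros) auto
    \<comment> \<open>\<open>Q\<close> maps the physical projection onto itself, so the inverse
      similarity stays in it and acts on stars as \<open>B *v (y - star_map Lt v)\<close>.\<close>
    have pv: "complex_of_real (p (inv (affine_sim Q v) (fst l))) = \<phi> (star_map Lt v)"
      if "v \<in> cp_set Lt ?U" for v
    proof -
      obtain l' where l': "l' \<in> Lt" "v = fst l'"
        using \<open>v \<in> cp_set Lt ?U\<close> unfolding cp_set_def by blast
      have "l - l' \<in> Lt"
        by (rule is_lattice_diff[OF lat l(1) l'(1)])
      then have "fst (l - l') \<in> (\<lambda>x. Q *v x) ` (fst ` Lt)"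
        unfolding QL by (rule imageI)
      then obtain l'' where l'': "l'' \<in> Lt" "fst (l - l') = Q *v fst l''"
        by blast
      have "inv (affine_sim Q v) (fst l) = Q' *v (Q *v fst l'')"
        using inv_affine_sim[OF Q', of v "fst l"] l'(2) l''(2) by simp
      also have "\<dots> = fst l''"
        using Q'(2) by (simp add: matrix_vector_mul_assoc)
      finally have inv_l: "inv (affine_sim Q v) (fst l) = fst l''" .
      have "A *v snd l'' = star_map Lt (Q *v fst l'')"
        using A l''(1) star_map_fst[OF cps l''(1)] unfolding induced_internal_map_def by simp
      also have "\<dots> = snd (l - l')"
        using star_map_fst[OF cps \<open>l - l' \<in> Lt\<close>] l''(2) by simp
      finally have "B *v (A *v snd l'') = B *v (y - star_map Lt v)"
        using l(2) l'(2) star_map_fst[OF cps l'(1)] by simp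
      then have "snd l'' = B *v (y - star_map Lt v)"
        using B(2) by (simp add: matrix_vector_mul_assoc)
      then show ?thesis
        unfolding inv_l \<phi>_def using p[OF l''(1)] by simp
    qed
    have "((\<lambda>s. \<bar>det Q\<bar> / real (card (ball_part (cp_set Lt ?U) s)) *
        (\<Sum>v\<in>ball_part (cp_set Lt ?U) s. p (inv (affine_sim Q v) (fst l)))) \<longlongrightarrow> p (fst l)) at_top"
      using inv l(1) unfolding invariant_density_def T by blast
    then have "((\<lambda>s. complex_of_real (\<bar>det Q\<bar> / real (card (ball_part (cp_set Lt ?U) s)) *
        (\<Sum>v\<in>ball_part (cp_set Lt ?U) s. p (inv (affine_sim Q v) (fst l))))) \<longlongrightarrow> complex_of_real (p (fst l))) at_top"
      by (rule tendsto_of_real)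
    moreover have E: "complex_of_real (\<bar>det Q\<bar> / real (card (ball_part (cp_set Lt ?U) s)) *
        (\<Sum>v\<in>ball_part (cp_set Lt ?U) s. p (inv (affine_sim Q v) (fst l))))
      = of_real \<bar>det Q\<bar> * (1 / of_nat (card (ball_part (cp_set Lt ?U) s)) *
        (\<Sum>v\<in>ball_part (cp_set Lt ?U) s. \<phi> (star_map Lt v)))" for s
    proof -
      have "(\<Sum>v\<in>ball_part (cp_set Lt ?U) s. complex_of_real (p (inv (affine_sim Q v) (fst l))))
          = (\<Sum>v\<in>ball_part (cp_set Lt ?U) s. \<phi> (star_map Lt v))"
        by (rule sum.cong[OF refl], rule pv) (simp add: ball_part_def)
      then show ?thesis by simp
    qed
    ultimately have "((\<lambda>s. of_real \<bar>det Q\<bar> * (1 / of_nat (card (ball_part (cp_set Lt ?U) s)) *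
        (\<Sum>v\<in>ball_part (cp_set Lt ?U) s. \<phi> (star_map Lt v)))) \<longlongrightarrow> complex_of_real (p (fst l))) at_top"
      by (simp only: E)
    moreover have "((\<lambda>s. of_real \<bar>det Q\<bar> * (1 / of_nat (card (ball_part (cp_set Lt ?U) s)) *
        (\<Sum>v\<in>ball_part (cp_set Lt ?U) s. \<phi> (star_map Lt v)))) \<longlongrightarrow> of_real \<bar>det Q\<bar> * window_mean ?U \<phi>) at_top"
      by (intro tendsto_mult tendsto_const cp_set_mean_tendsto[OF cps Uc U(2) measure_lborel_pos_interior[OF Uc U(1)] cont\<phi>])
    ultimately have "complex_of_real (p (fst l)) = of_real \<bar>det Q\<bar> * window_mean ?U \<phi>"
      using tendsto_unique trivial_limit_at_top_linorder by blast
    moreover have "window_mean ?U \<phi> = ?w * window_mean ?U (\<lambda>u. f (B *v (y - u)))"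
    proof -
      have *: "(\<lambda>u. indicator ?U u *\<^sub>R \<phi> u) = (\<lambda>u. ?w * (indicator ?U u *\<^sub>R f (B *v (y - u))))"
        by (simp add: \<phi>_def fun_eq_iff)
      show ?thesis
        unfolding window_mean_def * by (simp only: integral_mult_right_zero times_divide_eq_right)
    qed
    ultimately have "?w * f y = ?w * (of_real \<bar>det Q\<bar> * window_mean ?U (\<lambda>u. f (B *v (y - u))))"
      using p[OF l(1)] l(2) by simp
    then show "?F y = 0"
      using \<Omega>(3) by simp
  qed (simp add: dense)
  then show ?thesis by simp
qed

section \<open>The product formula\<close>

theorem proposition4:
  fixes Lt :: "((real^'m) \<times> (real^'n)) set"
    and \<Omega> :: "(real^'n) set"
    and Q :: "real^'m^'m"
    and A :: "real^'n^'n"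
    and p :: "real^'m \<Rightarrow> real"
  assumes "cut_and_project_scheme Lt"
    and "model_set_window \<Omega>"
    and "0 \<in> cp_set Lt \<Omega>"
    and "0 \<in> interior \<Omega>"
    and "linear_similarity Q"
    and "(\<lambda>x. Q *v x) ` (fst ` Lt) = fst ` Lt"
    and "induced_internal_map Lt Q A"
    and "\<forall>c. complex_eigenvalue A c \<longrightarrow> cmod c < 1"
    and "compatible_window A \<Omega>"
    and "frontier (window_translations A \<Omega>) \<in> null_sets lebesgue"
    and "invariant_density Lt \<Omega> Q A p"
    and "(\<lambda>x. complex_of_real (p x)) \<in> continuous_densities Lt \<Omega>"
  shows "\<exists>g h :: real^'m \<Rightarrow> complex.
    (\<forall>k. ((\<lambda>s. 1 / of_nat (card (ball_part (sim_translations Lt A \<Omega>) s)) *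
              (\<Sum>v \<in> ball_part (sim_translations Lt A \<Omega>) s. character k v)) \<longlongrightarrow> g k) at_top) \<and>
    (\<forall>k. ((\<lambda>s. 1 / of_nat (card (ball_part (cp_set Lt \<Omega>) s)) *
              (\<Sum>w \<in> ball_part (cp_set Lt \<Omega>) s. complex_of_real (p w) * character k w)) \<longlongrightarrow> h k) at_top) \<and>
    (\<forall>k. (\<lambda>n. \<Prod>N<n. g (((\<lambda>x. transpose Q *v x) ^^ N) k)) \<longlonglongrightarrow> h k)"
proof -
  note cps = assms(1) and QL = assms(6) and A = assms(7)
  let ?U = "window_translations A \<Omega>"
  let ?P = "\<lambda>N. (\<lambda>x. A *v x) ^^ N"
  have \<Omega>: "compact \<Omega>" "frontier \<Omega> \<in> null_sets lebesgue"
    using assms(2) unfolding model_set_window_def by auto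
  have \<Omega>0: "0 \<in> \<Omega>"
    using assms(4) interior_subset by blast
  have \<Omega>pos: "0 < measure lborel \<Omega>"
    using assms(4) by (intro measure_lborel_pos_interior \<Omega>(1)) auto
  have dense: "closure (snd ` Lt) = UNIV"
    using cps unfolding cut_and_project_scheme_def by blast
  have Uint: "interior ?U \<noteq> {}" and Ufr: "frontier ?U \<in> null_sets lebesgue"
    using assms(9,10) unfolding compatible_window_def by auto
  have Uc: "compact ?U"
    by (rule compact_window_translations[OF \<Omega>(1) \<Omega>0])
  have Upos: "0 < measure lborel ?U"
    by (rule measure_lborel_pos_interior[OF Uc Uint])
  have T: "sim_translations Lt A \<Omega> = cp_set Lt ?U"
    unfolding sim_translations_def cp_set_def ..
  obtain Q' where Q': "Q ** Q' = mat 1" "Q' ** Q = mat 1"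
  proof (rule surjective_matrix_inverse[of Q "fst ` Lt"])
    show "closure (span ((\<lambda>x. Q *v x) ` (fst ` Lt))) = UNIV"
      using QL fst_lattice_span[OF cps] by simp
  qed
  \<comment> \<open>Since \<open>Q\<close> is onto on the projected lattice, the image of
    \<open>A\<close> contains all internal coordinates of lattice points, which are dense; so
    \<open>A\<close> is invertible.\<close>
  have "snd l \<in> (\<lambda>x. A *v x) ` (snd ` Lt)" if "l \<in> Lt" for l
  proof -
    have "fst l \<in> (\<lambda>x. Q *v x) ` (fst ` Lt)"
      using that unfolding QL by simp
    then obtain l' where l': "l' \<in> Lt" "fst l = Q *v fst l'"
      by blast
    have "snd l = star_map Lt (Q *v fst l')"
      using star_map_fst[OF cps that] l'(2) by simp
    also have "\<dots> = A *v snd l'"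
      using A l'(1) star_map_fst[OF cps l'(1)] unfolding induced_internal_map_def by simp
    finally show ?thesis
      using l'(1) by simp
  qed
  then have "closure (snd ` Lt) \<subseteq> closure (span ((\<lambda>x. A *v x) ` (snd ` Lt)))"
    by (intro closure_mono) (meson image_subsetI span_superset subsetD)
  then obtain B where B: "A ** B = mat 1" "B ** A = mat 1"
    using surjective_matrix_inverse[of A "snd ` Lt"] dense by (metis top.extremum_uniqueI)
  obtain f where f: "continuous_on UNIV f" "closure {y. f y \<noteq> 0} \<subseteq> \<Omega>"
    and pf: "\<And>x. complex_of_real (p x) = density_of Lt \<Omega> f x"
    using assms(12) unfolding continuous_densities_def continuous_supported_def
    by (auto simp: fun_eq_iff)
  have f\<Omega>: "y \<in> \<Omega>" if "f y \<noteq> 0" for y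
    using f(2) closure_subset[of "{y. f y \<noteq> 0}"] that by blast
  have m\<Omega>: "measure lebesgue \<Omega> = measure lborel \<Omega>"
    using \<Omega>(1) by (simp add: borel_compact)
  \<comment> \<open>\<open>f\<close> vanishes off \<open>\<Omega>\<close>, so one formula covers all
    lattice points, inside the model set or not.\<close>
  have p: "complex_of_real (p (fst l)) = of_real (measure lborel \<Omega>) * f (snd l)" if "l \<in> Lt" for l
    using pf[of "fst l"] f\<Omega>[of "snd l"] that star_map_fst[OF cps that] unfolding density_of_def cp_set_def m\<Omega>
    by auto
  define \<phi> where "\<phi> y = of_real (measure lborel \<Omega>) * f y" for y
  have cont\<phi>: "continuous_on UNIV \<phi>"
    unfolding \<phi>_def by (intro continuous_on_mult continuous_on_const f(1))
  have p\<phi>: "complex_of_real (p w) = \<phi> (star_map Lt w)" if "w \<in> ball_part (cp_set Lt \<Omega>) s" for w s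
    using that p star_map_fst[OF cps] unfolding \<phi>_def ball_part_def cp_set_def by auto
  have mean\<phi>: "window_mean \<Omega> (\<lambda>y. \<phi> y * \<psi> y) = (LBINT y. f y * \<psi> y)" for \<psi>
  proof -
    have "(\<lambda>y. indicator \<Omega> y *\<^sub>R (\<phi> y * \<psi> y)) = (\<lambda>y. of_real (measure lborel \<Omega>) * (f y * \<psi> y))"
      using f\<Omega> by (auto simp: \<phi>_def indicator_def fun_eq_iff)
    then show ?thesis
      unfolding window_mean_def using \<Omega>pos by simp
  qed
  define G H where "G \<psi> = window_mean ?U \<psi>" and "H \<psi> = (LBINT y. f y * \<psi> y)" for \<psi> :: "real^'n \<Rightarrow> complex"
  \<comment> \<open>Normalization of the density and equidistribution evaluate the same
    averages.\<close>
  have H1: "H (\<lambda>_. 1) = 1"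
  proof -
    have "((\<lambda>s. complex_of_real (1 / real (card (ball_part (cp_set Lt \<Omega>) s)) * (\<Sum>x\<in>ball_part (cp_set Lt \<Omega>) s. p x)))
        \<longlongrightarrow> complex_of_real 1) at_top"
      using assms(11) unfolding invariant_density_def by (intro tendsto_of_real) blast
    then have "((\<lambda>s. 1 / of_nat (card (ball_part (cp_set Lt \<Omega>) s)) * (\<Sum>x\<in>ball_part (cp_set Lt \<Omega>) s. \<phi> (star_map Lt x)))
        \<longlongrightarrow> 1) at_top"
      by (simp add: p\<phi> cong: sum.cong)
    moreover have "((\<lambda>s. 1 / of_nat (card (ball_part (cp_set Lt \<Omega>) s)) * (\<Sum>x\<in>ball_part (cp_set Lt \<Omega>) s. \<phi> (star_map Lt x)))
        \<longlongrightarrow> window_mean \<Omega> \<phi>) at_top"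
      by (rule cp_set_mean_tendsto[OF cps \<Omega> \<Omega>pos cont\<phi>])
    ultimately have "window_mean \<Omega> \<phi> = 1"
      using tendsto_unique trivial_limit_at_top_linorder by blast
    then show ?thesis
      using mean\<phi>[of "\<lambda>_. 1"] by (simp add: H_def)
  qed
  obtain C where C: "\<And>\<psi>. continuous_on UNIV \<psi> \<Longrightarrow> (\<And>y. norm (\<psi> y) = 1) \<Longrightarrow> (\<And>u w. \<psi> (u + w) = \<psi> u * \<psi> w) \<Longrightarrow>
      H \<psi> = C * G \<psi> * H (\<lambda>y. \<psi> (A *v y))"
  proof (rule refinement_equation_transform[OF B f(1) f\<Omega> \<Omega>(1) Uc])
    show "f y = of_real \<bar>det Q\<bar> * window_mean ?U (\<lambda>u. f (B *v (y - u)))" for y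
      by (rule density_refinement_equation[OF cps \<Omega>(1) \<Omega>0 \<Omega>pos QL A Q' B Uint Ufr assms(11) f(1) f\<Omega> p])
  qed (auto simp: window_translations_def G_def H_def)
  have G1: "G (\<lambda>_. 1) = 1"
    unfolding G_def by (rule window_mean_1[OF Uc Upos])
  \<comment> \<open>The refinement identity at the trivial character reads
    \<open>1 = C * 1 * 1\<close>.\<close>
  have "C = 1"
    using C[of "\<lambda>_. 1"] G1 H1 by simp
  then have step: "H \<psi> = G \<psi> * H (\<lambda>y. \<psi> (A *v y))" if "internal_character Lt k \<psi>" for k \<psi>
    using C[of \<psi>] that unfolding internal_character_def by simp
  let ?avT = "\<lambda>k s. 1 / of_nat (card (ball_part (sim_translations Lt A \<Omega>) s)) *
      (\<Sum>v \<in> ball_part (sim_translations Lt A \<Omega>) s. character k v)"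
  let ?av\<Lambda> = "\<lambda>k s. 1 / of_nat (card (ball_part (cp_set Lt \<Omega>) s)) *
      (\<Sum>w \<in> ball_part (cp_set Lt \<Omega>) s. complex_of_real (p w) * character k w)"
  have av\<Lambda>: "?av\<Lambda> k = (\<lambda>s. 1 / of_nat (card (ball_part (cp_set Lt \<Omega>) s)) *
      (\<Sum>w \<in> ball_part (cp_set Lt \<Omega>) s. \<phi> (star_map Lt w) * character k w))" for k
    by (simp add: p\<phi> cong: sum.cong)
  have limT: "(?avT k \<longlongrightarrow> G \<psi>) at_top" if "internal_character Lt k \<psi>" for k \<psi>
    using cp_set_twisted_mean_tendsto[OF cps Uc Ufr Upos continuous_on_const[of _ 1] that] by (simp add: T G_def)
  have lim\<Lambda>: "(?av\<Lambda> k \<longlongrightarrow> H \<psi>) at_top" if "internal_character Lt k \<psi>" for k \<psi>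
    unfolding av\<Lambda> H_def mean\<phi>[symmetric] by (rule cp_set_twisted_mean_tendsto[OF cps \<Omega> \<Omega>pos cont\<phi> that])
  have limT0: "(?avT k \<longlongrightarrow> 0) at_top" if "\<nexists>\<psi>. internal_character Lt k \<psi>" for k
    using cp_set_twisted_mean_tendsto_0[OF cps Uc Ufr Upos continuous_on_const[of _ 1] that] by (simp add: T)
  have lim\<Lambda>0: "(?av\<Lambda> k \<longlongrightarrow> 0) at_top" if "\<nexists>\<psi>. internal_character Lt k \<psi>" for k
    unfolding av\<Lambda> by (rule cp_set_twisted_mean_tendsto_0[OF cps \<Omega> \<Omega>pos cont\<phi> that])
  \<comment> \<open>The character \<open>\<psi>\<close> depends on \<open>k\<close> and may fail to
    exist, so both functions are defined directly as limits and identified case by case.\<close>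
  define g h where "g k = Lim at_top (?avT k)" and "h k = Lim at_top (?av\<Lambda> k)" for k
  have g: "g k = l" if "(?avT k \<longlongrightarrow> l) at_top" for k l
    unfolding g_def using that by (intro tendsto_Lim) auto
  have h: "h k = l" if "(?av\<Lambda> k \<longlongrightarrow> l) at_top" for k l
    unfolding h_def using that by (intro tendsto_Lim) auto
  have "(?avT k \<longlongrightarrow> g k) at_top \<and> (?av\<Lambda> k \<longlongrightarrow> h k) at_top" for k
  proof (cases "\<exists>\<psi>. internal_character Lt k \<psi>")
    case True
    then obtain \<psi> where \<psi>: "internal_character Lt k \<psi>" by blast
    show ?thesis
      unfolding g[OF limT[OF \<psi>]] h[OF lim\<Lambda>[OF \<psi>]] by (intro conjI limT[OF \<psi>] lim\<Lambda>[OF \<psi>])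
  next
    case False
    show ?thesis
      unfolding g[OF limT0[OF False]] h[OF lim\<Lambda>0[OF False]] by (intro conjI limT0[OF False] lim\<Lambda>0[OF False])
  qed
  moreover have "(\<lambda>n. \<Prod>N<n. g (((\<lambda>x. transpose Q *v x) ^^ N) k)) \<longlonglongrightarrow> h k" for k
  proof (cases "\<exists>\<psi>. internal_character Lt k \<psi>")
    case True
    then obtain \<psi> where \<psi>: "internal_character Lt k \<psi>" by blast
    let ?\<psi> = "\<lambda>N y. \<psi> (?P N y)"
    have ic: "internal_character Lt (((\<lambda>x. transpose Q *v x) ^^ N) k) (?\<psi> N)" for N
      by (rule internal_character_funpow[OF cps QL A \<psi>])
    have prod: "H \<psi> = (\<Prod>N<n. g (((\<lambda>x. transpose Q *v x) ^^ N) k)) * H (?\<psi> n)" for n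
    proof (induction n)
      case (Suc n)
      have "H (?\<psi> n) = g (((\<lambda>x. transpose Q *v x) ^^ n) k) * H (?\<psi> (Suc n))"
        using step[OF ic[of n]] unfolding g[OF limT[OF ic[of n]]] by (simp only: funpow_Suc_right o_apply)
      then show ?case
        using Suc by (simp add: mult.assoc)
    qed simp
    have \<psi>_props: "continuous_on UNIV \<psi>" "\<And>y. norm (\<psi> y) = 1" "\<psi> 0 = 1"
    proof -
      show "continuous_on UNIV \<psi>" "\<And>y. norm (\<psi> y) = 1"
        using \<psi> unfolding internal_character_def by auto
      have "\<psi> (0 + 0) = \<psi> 0 * \<psi> 0" "norm (\<psi> 0) = 1"
        using \<psi> unfolding internal_character_def by blast+
      then show "\<psi> 0 = 1" by auto
    qed
    obtain M where M: "\<And>y. norm (f y) \<le> M"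
      using continuous_compact_support_bounded[OF f(1) \<Omega>(1) f\<Omega>] by blast
    have [measurable]: "f \<in> borel_measurable borel"
      using f(1) by (rule borel_measurable_continuous_onI)
    \<comment> \<open>\<open>?P n y\<close> tends to 0, so \<open>?\<psi> n\<close> tends pointwise
      to \<open>\<psi> 0 = 1\<close>, under a majorant supported on \<open>\<Omega>\<close>.\<close>
    have "(\<lambda>n. H (?\<psi> n)) \<longlonglongrightarrow> H (\<lambda>_. 1)"
      unfolding H_def
    proof (rule integral_dominated_convergence[where w="\<lambda>y. M * indicator \<Omega> y"])
      show "integrable lborel (\<lambda>y. M * indicator \<Omega> y)"
        using \<Omega>(1) by (intro integrable_mult_right integrable_indicator_bounded compact_imp_bounded) (auto simp: borel_compact)
      show "(\<lambda>y. f y * ?\<psi> n y) \<in> borel_measurable lborel" for n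
      proof -
        have "continuous_on UNIV (?\<psi> n)"
          using ic unfolding internal_character_def by blast
        then have "continuous_on UNIV (\<lambda>y. f y * ?\<psi> n y)"
          using f(1) by (rule continuous_on_mult[rotated])
        then show ?thesis
          using borel_measurable_continuous_onI by simp
      qed
      show "AE y in lborel. (\<lambda>n. f y * ?\<psi> n y) \<longlonglongrightarrow> f y * 1"
      proof (rule AE_I2)
        fix y
        have "(\<lambda>n. ?P n y) \<longlonglongrightarrow> 0"
          by (rule window_contraction[OF compact_imp_bounded[OF \<Omega>(1)] \<Omega>0 Uint])
        then have "(\<lambda>n. ?\<psi> n y) \<longlonglongrightarrow> \<psi> 0"
          using \<psi>_props(1) by (simp add: continuous_on_sequentially o_def)
        then show "(\<lambda>n. f y * ?\<psi> n y) \<longlonglongrightarrow> f y * 1"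
          unfolding \<psi>_props(3) by (intro tendsto_intros)
      qed
      show "AE y in lborel. norm (f y * ?\<psi> n y) \<le> M * indicator \<Omega> y" for n
        using M f\<Omega> \<psi>_props(2) by (intro AE_I2) (auto simp: norm_mult indicator_def)
    qed simp
    then have H_lim: "(\<lambda>n. H (?\<psi> n)) \<longlonglongrightarrow> 1"
      using H1 by simp
    have "(\<lambda>n. H \<psi> / H (?\<psi> n)) \<longlonglongrightarrow> H \<psi> / 1"
      by (intro tendsto_divide tendsto_const H_lim) simp
    moreover have "\<forall>\<^sub>F n in sequentially. H \<psi> / H (?\<psi> n) = (\<Prod>N<n. g (((\<lambda>x. transpose Q *v x) ^^ N) k))"
    proof -
      \<comment> \<open>The remaining factor is near 1 for large \<open>n\<close>, so dividing by it
        is safe even if some values of \<open>g\<close> are 0.\<close>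
      have "\<forall>\<^sub>F n in sequentially. H (?\<psi> n) \<noteq> 0"
        by (rule tendsto_imp_eventually_ne[OF H_lim]) simp
      then show ?thesis
      proof eventually_elim
        case (elim n)
        then show ?case
          by (subst prod[of n]) simp
      qed
    qed
    ultimately have "(\<lambda>n. \<Prod>N<n. g (((\<lambda>x. transpose Q *v x) ^^ N) k)) \<longlonglongrightarrow> H \<psi>"
      using Lim_transform_eventually by fastforce
    then show ?thesis
      using h[OF lim\<Lambda>[OF \<psi>]] by simp
  next
    case False
    have "g k = 0" "h k = 0"
      using g[OF limT0[OF False]] h[OF lim\<Lambda>0[OF False]] by auto
    \<comment> \<open>The factor with \<open>N = 0\<close> is \<open>g k = 0\<close>; only the empty
      product at \<open>n = 0\<close> escapes.\<close>
    then have "(\<Prod>N<n. g (((\<lambda>x. transpose Q *v x) ^^ N) k)) = 0" if "0 < n" for n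
      using that by (intro prod_zero) (auto intro!: bexI[of _ 0])
    then show ?thesis
      unfolding \<open>h k = 0\<close> by (intro tendsto_eventually eventually_mono[OF eventually_gt_at_top[of 0]]) auto
  qed
  ultimately show ?thesis
    by blast
qed

end
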